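(* Let $f_1,\dots,f_m:\mathbb{R}^2\to\mathbb{R}^2$ be linear automorphisms preserving volume up to sign, represented in some coordinate system by matrices $A_1,\dots,A_m\in SL_2^{\pm}(\mathbb{R})$, such that the induced maps $\psi_i\in PSL_2^\pm(\mathbb{R})$ of $\mathbb{R}P^1$ satisfy the open set condition with respect to some proper open subset $V\subset\mathbb{R}P^1$ and that, in some affine chart $\varphi$ of $\mathbb{R}P^1$ with values in $\mathbb{R}$ (whose domain contains $\overline V$), the $\psi_i$ are contractions on $\varphi(\overline V)$ with respect to the Euclidean distance. Let $R_{\mathbf A}=\bigcap_{k=1}^\infty\left(\bigcup_{|I|=k}\psi_I(V)\right)$ be the corresponding residual set. Then $2\dim_H R_{\mathbf A}=s_{\mathbf A}$.
   Context: $SL_2^\pm(\mathbb{R})$ is the group of real $2\times2$ matrices of determinant $\pm1$. For a word $I=i_1\dots i_k$ in the letters $1,\dots,m$, $|I|=k$, $A_I=A_{i_1}\cdots A_{i_k}$ and $\psi_I=\psi_{i_1}\circ\dots\circ\psi_{i_k}$. The open set condition with respect to $V$ means that $\psi_1(V),\dots,\psi_m(V)$ are pairwise disjoint and contained in $V$. A contraction is a map with Lipschitz constant strictly less than $1$. $\dim_H$ is Hausdorff dimension (with respect to the round metric on $\mathbb{R}P^1$, equivalently the Euclidean metric in the chart). $\mathbf A$ is the semigroup generated by $A_1,\dots,A_m$. With the max norm $\|M\|=\max_{i,j}|M^i_j|$, its exponent is $s_{\mathbf A}=\sup\{s\ge0:\sum_I\|A_I\|^{-s}=\infty\}$, the sum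 being over all finite words $I$ in the letters $1,\dots,m$ (including the empty word, for which $A_I$ is the identity).
   Formalization: V is assumed nonempty, m at least 1, and for m ≥ 2 the residual set R_A is assumed nonempty; without this the claim fails, e.g. for x/3, (x+2)/3 with V the interval (0,1) minus the Cantor set, where R_A is empty but s_A > 0. *)

theory Defs
  imports "HOL-Analysis.Analysis"
begin

section \<open>The real projective line with its round metric\<close>

definition rp1_rel :: "real^2 \<Rightarrow> real^2 \<Rightarrow> bool" where
  "rp1_rel x y \<longleftrightarrow> x \<noteq> 0 \<and> y \<noteq> 0 \<and> (\<exists>c. c \<noteq> 0 \<and> y = c *\<^sub>R x)"

lemma rp1_rel_part_equivp: "part_equivp rp1_rel"
proof (rule part_equivpI)
  show "\<exists>x. rp1_rel x x"
    by (rule exI[of _ "axis 1 1"]) (auto simp: rp1_rel_def axis_eq_0_iff intro: exI[of _ 1])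
  show "symp rp1_rel"
  proof (rule sympI)
    fix x y assume "rp1_rel x y"
    then obtain c where c: "x \<noteq> 0" "y \<noteq> 0" "c \<noteq> 0" "y = c *\<^sub>R x"
      by (auto simp: rp1_rel_def)
    then have "x = inverse c *\<^sub>R y" by simp
    with c show "rp1_rel y x"
      unfolding rp1_rel_def by (metis inverse_nonzero_iff_nonzero)
  qed
  show "transp rp1_rel"
    by (rule transpI) (auto simp: rp1_rel_def)
qed

quotient_type rp1 = "real^2" / partial: rp1_rel
  by (rule rp1_rel_part_equivp)

text \<open>The point \<open>[x\<^sub>1 : x\<^sub>2]\<close>; meaningful only for nonzero \<open>x\<close>.\<close>

definition proj :: "real^2 \<Rightarrow> rp1" where
  "proj x = abs_rp1 x"

lemma rep_rp1_nonzero: "rep_rp1 p \<noteq> 0"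
  using Quotient3_rep_reflp[OF Quotient3_rp1, of p] by (simp add: rp1_rel_def)

lemma proj_rep_rp1: "proj (rep_rp1 p) = p"
  unfolding proj_def by (rule Quotient3_abs_rep[OF Quotient3_rp1])

lemma proj_eq_iff:
  assumes "x \<noteq> 0" "y \<noteq> 0"
  shows "proj x = proj y \<longleftrightarrow> (\<exists>c. c \<noteq> 0 \<and> y = c *\<^sub>R x)"
proof -
  have "rp1_rel x x" "rp1_rel y y"
    using assms by (auto simp: rp1_rel_def intro: exI[of _ 1])
  then show ?thesis
    using Quotient3_rel[OF Quotient3_rp1, of x y] assms
    by (auto simp: proj_def rp1_rel_def)
qed

lemma abs_cos_shift: "\<bar>cos (t - of_int k * pi)\<bar> = \<bar>cos t\<bar>"
proof -
  have s: "sin (of_int k * pi) = 0"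
    by (simp add: sin_zero_iff_int2)
  have "(cos (of_int k * pi))\<^sup>2 = (1::real)"
    using sin_cos_squared_add[of "of_int k * pi"] s by simp
  then have "\<bar>cos (of_int k * pi)\<bar> = (1::real)"
    by (simp add: abs_square_eq_1)
  with s show ?thesis by (simp add: cos_diff abs_mult)
qed

lemma arccos_abs_cos_le: "arccos \<bar>cos t\<bar> \<le> \<bar>t - of_int k * pi\<bar>"
  and arccos_abs_cos_eq':
    "\<bar>t - of_int k * pi\<bar> \<le> pi / 2 \<Longrightarrow> arccos \<bar>cos t\<bar> = \<bar>t - of_int k * pi\<bar>"
proof -
  show *: "arccos \<bar>cos t\<bar> = \<bar>t - of_int k * pi\<bar>"
    if "\<bar>t - of_int k * pi\<bar> \<le> pi / 2" for k
  proof -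
    have "\<bar>cos t\<bar> = \<bar>cos (t - of_int k * pi)\<bar>"
      by (simp only: abs_cos_shift)
    also have "\<dots> = cos (t - of_int k * pi)"
      using that by (intro abs_of_nonneg cos_ge_zero) linarith+
    also have "\<dots> = cos \<bar>t - of_int k * pi\<bar>"
      by simp
    finally have "\<bar>cos t\<bar> = cos \<bar>t - of_int k * pi\<bar>" .
    moreover have "\<bar>t - of_int k * pi\<bar> \<le> pi"
      using that pi_gt_zero by linarith
    ultimately show ?thesis
      using arccos_cos[of "\<bar>t - of_int k * pi\<bar>"] by simp
  qed
  have "arccos \<bar>cos t\<bar> \<le> pi / 2"
    by (rule arccos_le_pi2) auto
  with *[of k] show "arccos \<bar>cos t\<bar> \<le> \<bar>t - of_int k * pi\<bar>"
    by linarith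
qed

lemma arccos_abs_cos_eq: "\<exists>k::int. arccos \<bar>cos t\<bar> = \<bar>t - of_int k * pi\<bar>"
proof -
  have "\<bar>of_int (round (t / pi)) - t / pi\<bar> * pi \<le> 1 / 2 * pi"
    by (intro mult_right_mono of_int_round_abs_le) auto
  moreover have "\<bar>of_int (round (t / pi)) - t / pi\<bar> * pi = \<bar>t - of_int (round (t / pi)) * pi\<bar>"
  proof -
    have "\<bar>of_int (round (t / pi)) - t / pi\<bar> * pi
        = \<bar>(of_int (round (t / pi)) - t / pi) * pi\<bar>"
      by (simp add: abs_mult)
    also have "(of_int (round (t / pi)) - t / pi) * pi = of_int (round (t / pi)) * pi - t"
      by (simp add: left_diff_distrib)
    finally show ?thesis by (simp add: abs_minus_commute)
  qed
  ultimately show ?thesis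
    by (intro exI[of _ "round (t / pi)"] arccos_abs_cos_eq') simp
qed

lemma polar_vec2:
  obtains a where "x $ 1 = norm x * cos a" "x $ 2 = norm (x::real^2) * sin a"
proof (cases "x = 0")
  case False
  have "(norm x)\<^sup>2 = (x$1)\<^sup>2 + (x$2)\<^sup>2"
    by (simp add: norm_vec_def L2_set_def sum_2)
  then have "(x$1 / norm x)\<^sup>2 + (x$2 / norm x)\<^sup>2 = (norm x)\<^sup>2 / (norm x)\<^sup>2"
    by (simp only: power_divide add_divide_distrib)
  also have "\<dots> = 1"
    using False by simp
  finally have "(x$1 / norm x)\<^sup>2 + (x$2 / norm x)\<^sup>2 = 1" .
  then obtain a where "x$1 / norm x = cos a" "x$2 / norm x = sin a"
    by (metis sincos_total_2pi)
  with False show ?thesis by (intro that[of a]) (auto simp: field_simps)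
qed (use that in auto)

lemma inner_polar:
  fixes x y :: "real^2"
  assumes "x \<noteq> 0" "y \<noteq> 0"
    and "x $ 1 = norm x * cos a" "x $ 2 = norm x * sin a"
    and "y $ 1 = norm y * cos b" "y $ 2 = norm y * sin b"
  shows "\<bar>x \<bullet> y\<bar> / (norm x * norm y) = \<bar>cos (a - b)\<bar>"
proof -
  have "x \<bullet> y = x$1 * y$1 + x$2 * y$2"
    by (simp add: inner_vec_def sum_2)
  also have "\<dots> = norm x * norm y * cos (a - b)"
    unfolding assms(3-6) cos_diff by algebra
  finally show ?thesis
    using assms(1,2) by (simp add: abs_mult)
qed

instantiation rp1 :: metric_space
begin

text \<open>The distance of two lines is the angle between them.\<close>

definition dist_rp1 :: "rp1 \<Rightarrow> rp1 \<Rightarrow> real" where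
  "dist_rp1 p q =
     arccos (\<bar>rep_rp1 p \<bullet> rep_rp1 q\<bar> / (norm (rep_rp1 p) * norm (rep_rp1 q)))"

definition uniformity_rp1 :: "(rp1 \<times> rp1) filter" where
  "uniformity_rp1 = (INF e\<in>{0<..}. principal {(x, y). dist x y < e})"

definition open_rp1 :: "rp1 set \<Rightarrow> bool" where
  "open_rp1 U \<longleftrightarrow> (\<forall>x\<in>U. eventually (\<lambda>(x', y). x' = x \<longrightarrow> y \<in> U) uniformity)"

instance
proof
  show "uniformity = (INF e\<in>{0<..}. principal {(x::rp1, y). dist x y < e})"
    by (rule uniformity_rp1_def)
  show "open U \<longleftrightarrow> (\<forall>x\<in>U. eventually (\<lambda>(x', y). x' = x \<longrightarrow> y \<in> U) uniformity)"
    for U :: "rp1 set"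
    by (rule open_rp1_def)
next
  fix p q :: rp1
  show "dist p q = 0 \<longleftrightarrow> p = q"
  proof
    assume d: "dist p q = 0"
    let ?x = "rep_rp1 p" and ?y = "rep_rp1 q"
    obtain a b where ab: "?x $ 1 = norm ?x * cos a" "?x $ 2 = norm ?x * sin a"
        "?y $ 1 = norm ?y * cos b" "?y $ 2 = norm ?y * sin b"
      by (metis polar_vec2)
    obtain k :: int where "arccos \<bar>cos (a - b)\<bar> = \<bar>a - b - of_int k * pi\<bar>"
      using arccos_abs_cos_eq by blast
    with d have "a - b = of_int k * pi"
      using inner_polar[OF rep_rp1_nonzero rep_rp1_nonzero ab] by (simp add: dist_rp1_def)
    then have "sin (b - a) = 0"
      by (metis minus_diff_eq mult_minus_left of_int_minus sin_zero_iff_int2)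
    then have s: "sin b * cos a = cos b * sin a"
      by (simp add: sin_diff)
    let ?c = "norm ?y / norm ?x * cos (b - a)"
    have "sin b = cos (b - a) * sin a"
    proof -
      have "cos (b - a) * sin a = cos a * sin a * cos b + sin b * (sin a * sin a)"
        by (simp add: cos_diff algebra_simps)
      also have "\<dots> = sin b * cos a * cos a + sin b * (sin a * sin a)"
        using s by algebra
      also have "\<dots> = sin b"
        using sin_cos_squared_add[of a] by algebra
      finally show ?thesis by simp
    qed
    moreover have "cos b = cos (b - a) * cos a"
    proof -
      have "cos (b - a) * cos a = cos b * (cos a * cos a) + sin b * cos a * sin a"
        by (simp add: cos_diff algebra_simps)
      also have "\<dots> = cos b"
        using s sin_cos_squared_add[of a] by algebra
      finally show ?thesis by simp
    qed
    ultimately have "?y $ 1 = ?c * ?x $ 1" "?y $ 2 = ?c * ?x $ 2"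
      using rep_rp1_nonzero[of p] unfolding ab by simp_all
    then have y: "?y = ?c *\<^sub>R ?x"
      by (simp add: vec_eq_iff forall_2)
    moreover have "?c \<noteq> 0"
      using y rep_rp1_nonzero[of q] by (metis scaleR_zero_left)
    ultimately show "p = q"
      using proj_eq_iff[OF rep_rp1_nonzero rep_rp1_nonzero, of p q]
      unfolding proj_rep_rp1 by metis
  next
    assume "p = q"
    then show "dist p q = 0"
      using rep_rp1_nonzero[of p]
      by (simp add: dist_rp1_def power2_norm_eq_inner flip: power2_eq_square)
  qed
next
  fix p q r :: rp1
  let ?x = "rep_rp1 p" and ?y = "rep_rp1 q" and ?z = "rep_rp1 r"
  obtain a b c where abc: "?x $ 1 = norm ?x * cos a" "?x $ 2 = norm ?x * sin a"
      "?y $ 1 = norm ?y * cos b" "?y $ 2 = norm ?y * sin b"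
      "?z $ 1 = norm ?z * cos c" "?z $ 2 = norm ?z * sin c"
    by (metis polar_vec2)
  note nz = rep_rp1_nonzero
  obtain k l :: int where kl: "arccos \<bar>cos (a - c)\<bar> = \<bar>a - c - of_int k * pi\<bar>"
      "arccos \<bar>cos (b - c)\<bar> = \<bar>b - c - of_int l * pi\<bar>"
    using arccos_abs_cos_eq by metis
  have "arccos \<bar>cos (a - b)\<bar> \<le> \<bar>a - b - of_int (k - l) * pi\<bar>"
    by (rule arccos_abs_cos_le)
  also have "\<dots> \<le> \<bar>a - c - of_int k * pi\<bar> + \<bar>b - c - of_int l * pi\<bar>"
    by (simp add: left_diff_distrib)
  finally show "dist p q \<le> dist p r + dist q r"
    using inner_polar[OF nz nz abc(1-4)] inner_polar[OF nz nz abc(1,2,5,6)]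
      inner_polar[OF nz nz abc(3-6)] kl
    by (simp add: dist_rp1_def)
qed

end

lemma dist_proj:
  assumes "x \<noteq> 0" "y \<noteq> 0"
  shows "dist (proj x) (proj y) = arccos (\<bar>x \<bullet> y\<bar> / (norm x * norm y))"
proof -
  obtain c where c: "c \<noteq> 0" "rep_rp1 (proj x) = c *\<^sub>R x"
    using proj_eq_iff[OF assms(1) rep_rp1_nonzero] by (metis proj_rep_rp1)
  obtain d where d: "d \<noteq> 0" "rep_rp1 (proj y) = d *\<^sub>R y"
    using proj_eq_iff[OF assms(2) rep_rp1_nonzero] by (metis proj_rep_rp1)
  show ?thesis
    using c d assms by (simp add: dist_rp1_def abs_mult)
qed

text \<open>The projective map induced by a linear automorphism of the plane.\<close>

definition proj_map :: "(real^2 \<Rightarrow> real^2) \<Rightarrow> rp1 \<Rightarrow> rp1" where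
  "proj_map f p = proj (f (rep_rp1 p))"

lemma proj_map_proj:
  assumes "linear f" "bij f" "x \<noteq> 0"
  shows "proj_map f (proj x) = proj (f x)"
proof -
  obtain c where c: "c \<noteq> 0" "rep_rp1 (proj x) = c *\<^sub>R x"
    using proj_eq_iff[OF assms(3) rep_rp1_nonzero] by (metis proj_rep_rp1)
  have "f y \<noteq> 0" if "y \<noteq> 0" for y
    using that assms(1,2) by (metis bij_is_inj injD linear_0)
  then show ?thesis
    using c assms proj_eq_iff[of "f x" "f (c *\<^sub>R x)"]
    by (auto simp: proj_map_def linear_scale)
qed

section \<open>Linear data\<close>

definition area :: "real^2 \<Rightarrow> real^2 \<Rightarrow> real" where
  "area u v = u$1 * v$2 - u$2 * v$1"

text \<open>
  An affine chart with domain \<open>D\<close>: the ratio of two independent linear forms, defined off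
  the zero of the denominator.
\<close>

definition affine_chart :: "rp1 set \<Rightarrow> (rp1 \<Rightarrow> real) \<Rightarrow> bool" where
  "affine_chart D \<phi> \<longleftrightarrow> (\<exists>a b. area a b \<noteq> 0 \<and> D = proj ` {x. b \<bullet> x \<noteq> 0} \<and>
     (\<forall>x. b \<bullet> x \<noteq> 0 \<longrightarrow> \<phi> (proj x) = (a \<bullet> x) / (b \<bullet> x)))"

definition preserves_area_up_to_sign :: "(real^2 \<Rightarrow> real^2) \<Rightarrow> bool" where
  "preserves_area_up_to_sign f \<longleftrightarrow>
     (\<exists>\<epsilon>\<in>{1, -1}. \<forall>u v. area (f u) (f v) = \<epsilon> * area u v)"

definition SL2pm :: "(real^2^2) set" where
  "SL2pm = {M. det M = 1 \<or> det M = -1}"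

definition is_basis :: "(2 \<Rightarrow> real^2) \<Rightarrow> bool" where
  "is_basis b \<longleftrightarrow> inj b \<and> independent (range b) \<and> span (range b) = UNIV"

definition represents :: "(2 \<Rightarrow> real^2) \<Rightarrow> (real^2 \<Rightarrow> real^2) \<Rightarrow> real^2^2 \<Rightarrow> bool" where
  "represents b f M \<longleftrightarrow> (\<forall>j. f (b j) = (\<Sum>i\<in>UNIV. M$i$j *\<^sub>R b i))"

section \<open>Words, the exponent and the residual set\<close>

definition word_matrix :: "(nat \<Rightarrow> real^2^2) \<Rightarrow> nat list \<Rightarrow> real^2^2" where
  "word_matrix A I = foldr (\<lambda>i M. A i ** M) I (mat 1)"

definition word_map :: "(nat \<Rightarrow> 'a \<Rightarrow> 'a) \<Rightarrow> nat list \<Rightarrow> 'a \<Rightarrow> 'a" where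
  "word_map \<psi> I = foldr (\<lambda>i g. \<psi> i \<circ> g) I id"

definition max_norm :: "real^2^2 \<Rightarrow> real" where
  "max_norm M = Max {\<bar>M$i$j\<bar> | i j. True}"

text \<open>
  A sum over words, not over distinct products: a matrix is counted once for every word
  that represents it.
\<close>

definition exponent :: "nat \<Rightarrow> (nat \<Rightarrow> real^2^2) \<Rightarrow> ennreal" where
  "exponent m A = (SUP s\<in>{s::real. 0 \<le> s \<and>
     (\<Sum>\<^sub>\<infinity>I\<in>lists {1..m}. ennreal (max_norm (word_matrix A I) powr (-s))) = \<infinity>}. ennreal s)"

text \<open>
  The images are those of \<open>V\<close> itself, not of its closure, so for a bad choice of \<open>V\<close> the
  residual set can miss the whole attractor: in the chart, take \<open>x \<mapsto> x / 3\<close>,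
  \<open>x \<mapsto> (x + 2) / 3\<close> and for \<open>V\<close> the open unit interval minus the ternary Cantor set.
  The open set condition holds, but the residual set is empty.
\<close>

definition residual_set :: "nat \<Rightarrow> (nat \<Rightarrow> 'a \<Rightarrow> 'a) \<Rightarrow> 'a set \<Rightarrow> 'a set" where
  "residual_set m \<psi> V =
     (\<Inter>k\<in>{1..}. \<Union>I\<in>{I \<in> lists {1..m}. length I = k}. word_map \<psi> I ` V)"

definition open_set_condition :: "nat \<Rightarrow> (nat \<Rightarrow> 'a \<Rightarrow> 'a) \<Rightarrow> 'a set \<Rightarrow> bool" where
  "open_set_condition m \<psi> V \<longleftrightarrow>
     (\<forall>i\<in>{1..m}. \<psi> i ` V \<subseteq> V) \<and> disjoint_family_on (\<lambda>i. \<psi> i ` V) {1..m}"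

section \<open>Contractions and Hausdorff dimension\<close>

definition contraction_on :: "'a::metric_space set \<Rightarrow> ('a \<Rightarrow> 'b::metric_space) \<Rightarrow> bool" where
  "contraction_on X g \<longleftrightarrow> (\<exists>L<1. L-lipschitz_on X g)"

text \<open>
  The case distinction is the convention that \<open>diam\<^sup>0\<close> is 1 for a nonempty set
  (\<open>0 powr 0 = 0\<close> in the library). Boundedness is needed because \<^const>\<open>diameter\<close> is
  unspecified on unbounded sets.
\<close>

definition hausdorff_gauge :: "real \<Rightarrow> 'a::metric_space set \<Rightarrow> ennreal" where
  "hausdorff_gauge s U =
     (if U = {} then 0 else if s = 0 then 1 else ennreal (diameter U powr s))"

definition hausdorff_content :: "real \<Rightarrow> real \<Rightarrow> 'a::metric_space set \<Rightarrow> ennreal" where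
  "hausdorff_content s \<delta> S =
     (INF U\<in>{U::nat \<Rightarrow> 'a set. S \<subseteq> (\<Union>n. U n) \<and> (\<forall>n. bounded (U n) \<and> diameter (U n) \<le> \<delta>)}.
        \<Sum>n. hausdorff_gauge s (U n))"

definition hausdorff_measure :: "real \<Rightarrow> 'a::metric_space set \<Rightarrow> ennreal" where
  "hausdorff_measure s S = (SUP \<delta>\<in>{0<..}. hausdorff_content s \<delta> S)"

definition hausdorff_dim :: "'a::metric_space set \<Rightarrow> ennreal" where
  "hausdorff_dim S = (INF s\<in>{s. 0 \<le> s \<and> hausdorff_measure s S = 0}. ennreal s)"

end

theory Submission
  imports Defs
begin

text \<open>
  In the chart, the derivative of \<open>\<psi>\<^sub>I\<close> at a point is the inverse square of the denominator of
  \<open>A\<^sub>I\<close> there. By the contraction hypothesis the logarithms of these denominators have bounded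
  distortion on \<open>V\<close>, so the denominators are comparable with the norm of \<open>A\<^sub>I\<close>, and \<open>\<psi>\<^sub>I\<close> changes
  distances on \<open>V\<close> by a factor comparable with \<open>\<rho>\<^sub>I = \<parallel>A\<^sub>I\<parallel>\<^sup>-\<^sup>2\<close>. If \<open>\<Sum>\<rho>\<^sub>I\<^sup>s\<close> converges, the covers by the
  sets \<open>\<psi>\<^sub>I(V)\<close> with \<open>|I| = n\<close> show that the \<open>s\<close>-dimensional measure of the residual set vanishes.
  If it diverges at some \<open>t > s\<close>, the sums over \<open>|I| = n\<close> of \<open>\<rho>\<^sub>I\<^sup>s\<close> are unbounded, because \<open>\<rho>\<^sub>I\<close>
  decays exponentially in \<open>|I|\<close>; hence some level contains a separated Cantor set of positive
  \<open>s\<close>-dimensional measure.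
\<close>

section \<open>A lower bound for Hausdorff measures\<close>

text \<open>Area preservation up to sign yields an exact two-point formula: a word divides the chart
  distance of two points by the product of its denominators at these points. No mean value argument
  occurs, so \<open>V\<close> may be disconnected. Denominators of single letters are affine in the
  chart coordinate, and the contraction hypothesis forces them to be at least 1 in absolute value on
  \<open>V\<close>. This turns an additive Lipschitz bound into a relative one, and the relative
  errors along a word form a geometric series.

  The residual set is built from images of \<open>V\<close> itself, not of its closure; it need not
  be closed and may be empty. Hence limits of branches have to be forced back into \<open>V\<close>,
  and nonemptiness enters for two or more maps; for a single map both sides are 0.

  The gap between s and t absorbs every multiplicative constant, so only unboundedness of the level
  sums at s matters, not their growth rate. The factor 2 in the result is the exponent in the
  definition of the ratios.\<close>

lemma separated_tree_point_cover:
  fixes x :: "(nat \<Rightarrow> 'w) \<Rightarrow> 'a::metric_space"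
  assumes "w0 \<in> S" and r: "\<And>w. w \<in> S \<Longrightarrow> 0 < r w \<and> r w \<le> 1/2"
    and "s > 0" "\<delta> > 0" "\<eta> > 0" "bounded U"
    and sep: "\<And>\<omega> \<tau> k. \<omega> \<in> UNIV \<rightarrow> S \<Longrightarrow> \<tau> \<in> UNIV \<rightarrow> S \<Longrightarrow> (\<And>j. j < k \<Longrightarrow> \<omega> j = \<tau> j) \<Longrightarrow>
       \<omega> k \<noteq> \<tau> k \<Longrightarrow> \<delta> * (\<Prod>j<k. r (\<omega> j)) \<le> dist (x \<omega>) (x \<tau>)"
  shows "\<exists>u\<in>lists S. (\<forall>\<omega>\<in>UNIV \<rightarrow> S. x \<omega> \<in> U \<longrightarrow> map \<omega> [0..<length u] = u) \<and>
           prod_list (map r u) powr s \<le> (diameter U / \<delta>) powr s + \<eta>"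
proof -
  have pl: "prod_list (map r (map \<omega> [0..<k])) = (\<Prod>j<k. r (\<omega> j))" for \<omega> :: "nat \<Rightarrow> 'w" and k
    by (induction k) (auto simp: mult.commute)
  \<comment> \<open>All ratios are at most 1/2, so words of a fixed length \<open>k\<close> weigh
    less than \<eta>. They serve for sets that meet at most one branch, whose diameter may be
    0.\<close>
  have "(\<lambda>k. ((1/2) powr s) ^ k) \<longlonglongrightarrow> 0"
    using \<open>s > 0\<close> by (intro LIMSEQ_power_zero) (auto simp: powr01_less_one)
  then have "eventually (\<lambda>k. ((1/2) powr s) ^ k < \<eta>) sequentially"
    using \<open>\<eta> > 0\<close> by (rule order_tendstoD)
  then obtain k where k: "((1/2) powr s) ^ k < \<eta>"
    by (metis eventually_happens trivial_limit_sequentially)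
  have deep: "prod_list (map r u) powr s \<le> \<eta>" if "u \<in> lists S" "length u = k" for u
  proof -
    have "0 \<le> prod_list (map r u) \<and> prod_list (map r u) \<le> (1/2) ^ length u"
      using that(1)
    proof (induction u)
      case (Cons w u)
      then have IH: "0 \<le> prod_list (map r u)" "prod_list (map r u) \<le> (1/2) ^ length u"
        and w: "0 < r w" "r w \<le> 1/2" using r[of w] by auto
      have "r w * prod_list (map r u) \<le> (1/2) * (1/2) ^ length u"
        by (rule mult_mono) (use IH w in auto)
      then show ?case using IH w by simp
    qed auto
    then have "prod_list (map r u) powr s \<le> ((1/2) ^ k) powr s"
      using that \<open>s > 0\<close> by (intro powr_mono2) auto
    also have "\<dots> = ((1/2) powr s) ^ k"
      by (simp add: powr_power powr_powr mult.commute flip: powr_realpow)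
    finally show ?thesis using k by linarith
  qed
  have dnn: "0 \<le> (diameter U / \<delta>) powr s" by simp
  \<comment> \<open>The word sought is the longest common prefix of the branches with points in
    \<open>U\<close>: two branches parting there have points in \<open>U\<close> at least \<delta>
    times the prefix product apart, which bounds that product by
    \<open>diameter U / \<delta>\<close>. If at most one branch leads into \<open>U\<close>, there
    is no such parting and a word of length \<open>k\<close> is taken.\<close>
  show ?thesis
  proof (cases "\<exists>\<omega>0\<in>UNIV \<rightarrow> S. x \<omega>0 \<in> U")
    case False
    have "replicate k w0 \<in> lists S" using \<open>w0 \<in> S\<close> by auto
    moreover have "prod_list (map r (replicate k w0)) powr s \<le> (diameter U / \<delta>) powr s + \<eta>"
      using deep[OF calculation length_replicate] dnn by linarith
    ultimately show ?thesis using False by blast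
  next
    case True
    then obtain \<omega>0 where \<omega>0: "\<omega>0 \<in> UNIV \<rightarrow> S" "x \<omega>0 \<in> U" by blast
    have lst: "map \<omega>0 [0..<i] \<in> lists S" for i using \<omega>0(1) by (auto simp: Pi_iff)
    define P where "P = (\<lambda>j. \<exists>\<omega>\<in>UNIV \<rightarrow> S. x \<omega> \<in> U \<and> \<omega> j \<noteq> \<omega>0 j)"
    show ?thesis
    proof (cases "\<exists>j. P j")
      case False
      then have agree: "\<And>\<omega>. \<omega> \<in> UNIV \<rightarrow> S \<Longrightarrow> x \<omega> \<in> U \<Longrightarrow> \<omega> = \<omega>0" by (auto simp: P_def)
      have "prod_list (map r (map \<omega>0 [0..<k])) powr s \<le> (diameter U / \<delta>) powr s + \<eta>"
        using deep[OF lst[of k]] dnn by (simp add: add_increasing)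
      then show ?thesis
        by (intro bexI[OF _ lst[of k]] conjI ballI impI) (auto dest: agree)
    next
      case True
      define j where "j = (LEAST j. P j)"
      have "P j" using True unfolding j_def by (rule LeastI_ex)
      then obtain \<omega> where \<omega>: "\<omega> \<in> UNIV \<rightarrow> S" "x \<omega> \<in> U" "\<omega> j \<noteq> \<omega>0 j"
        by (auto simp: P_def)
      have nP: "\<not> P i" if "i < j" for i
        using that unfolding j_def by (rule not_less_Least)
      have "\<delta> * (\<Prod>i<j. r (\<omega>0 i)) \<le> dist (x \<omega>0) (x \<omega>)"
        using nP \<omega> by (intro sep \<omega>0(1)) (auto simp: P_def)
      also have "\<dots> \<le> diameter U"
        by (intro diameter_bounded_bound \<open>bounded U\<close> \<omega>0 \<omega>)
      finally have "(\<Prod>i<j. r (\<omega>0 i)) \<le> diameter U / \<delta>"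
        using \<open>\<delta> > 0\<close> by (simp add: field_simps)
      moreover have "0 \<le> (\<Prod>i<j. r (\<omega>0 i))"
        using r \<omega>0(1) by (intro prod_nonneg) (auto intro: less_imp_le simp: Pi_iff)
      ultimately have "prod_list (map r (map \<omega>0 [0..<j])) powr s \<le> (diameter U / \<delta>) powr s"
        unfolding pl using \<open>s > 0\<close> by (intro powr_mono2) auto
      then have wt: "prod_list (map r (map \<omega>0 [0..<j])) powr s \<le> (diameter U / \<delta>) powr s + \<eta>"
        using \<open>\<eta> > 0\<close> by linarith
      have "map \<omega>' [0..<j] = map \<omega>0 [0..<j]" if "\<omega>' \<in> UNIV \<rightarrow> S" "x \<omega>' \<in> U" for \<omega>'
        using nP that by (auto simp: P_def)
      with wt show ?thesis
        by (intro bexI[OF _ lst[of j]] conjI ballI impI) simp_all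
    qed
  qed
qed

text \<open>
  If a cover of the tree had total weight below 1, then some child of every vertex would carry
  less covering weight than its own weight; descending through such children produces an
  infinite branch that is not covered. This replaces the mass distribution principle.
\<close>

lemma hausdorff_measure_pos_of_separated_tree:
  fixes x :: "(nat \<Rightarrow> 'w) \<Rightarrow> 'a::metric_space"
  assumes "finite S" and r: "\<And>w. w \<in> S \<Longrightarrow> 0 < r w \<and> r w \<le> 1/2"
    and "s > 0" and sum1: "1 \<le> (\<Sum>w\<in>S. r w powr s)" and "\<delta> > 0"
    and sep: "\<And>\<omega> \<tau> k. \<omega> \<in> UNIV \<rightarrow> S \<Longrightarrow> \<tau> \<in> UNIV \<rightarrow> S \<Longrightarrow> (\<And>j. j < k \<Longrightarrow> \<omega> j = \<tau> j) \<Longrightarrow>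
       \<omega> k \<noteq> \<tau> k \<Longrightarrow> \<delta> * (\<Prod>j<k. r (\<omega> j)) \<le> dist (x \<omega>) (x \<tau>)"
    and xR: "\<And>\<omega>. \<omega> \<in> UNIV \<rightarrow> S \<Longrightarrow> x \<omega> \<in> R"
  shows "hausdorff_measure s R \<noteq> 0"
proof -
  obtain w0 where "w0 \<in> S" using sum1 by fastforce
  \<comment> \<open>The error terms \<open>(1/2) ^ Suc (Suc n)\<close> add up to 1/2, which leaves
    1/2 for the gauges divided by \<open>\<delta> powr s\<close>; the two halves make up the weight
    1 of the root.\<close>
  have low: "ennreal (\<delta> powr s / 2) \<le> (\<Sum>n. hausdorff_gauge s (U n))"
    if cov: "R \<subseteq> (\<Union>n. U n)" and bdd: "\<And>n. bounded (U n)" for U :: "nat \<Rightarrow> 'a set"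
  proof (rule ccontr)
    assume "\<not> ?thesis"
    then have small: "(\<Sum>n. hausdorff_gauge s (U n)) < ennreal (\<delta> powr s / 2)" by simp
    define wt where "wt = (\<lambda>u. prod_list (map r u) powr s)"
    have "\<exists>u\<in>lists S. (\<forall>\<omega>\<in>UNIV \<rightarrow> S. x \<omega> \<in> U n \<longrightarrow> map \<omega> [0..<length u] = u) \<and>
           wt u \<le> (diameter (U n) / \<delta>) powr s + (1/2) ^ Suc (Suc n)" for n
      unfolding wt_def
      by (rule separated_tree_point_cover[OF \<open>w0 \<in> S\<close> r \<open>s > 0\<close> \<open>\<delta> > 0\<close> _ bdd sep]) auto
    then obtain u where u: "\<And>n. u n \<in> lists S"
      "\<And>n \<omega>. \<omega> \<in> UNIV \<rightarrow> S \<Longrightarrow> x \<omega> \<in> U n \<Longrightarrow> map \<omega> [0..<length (u n)] = u n"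
      "\<And>n. wt (u n) \<le> (diameter (U n) / \<delta>) powr s + (1/2) ^ Suc (Suc n)"
      by metis
    \<comment> \<open>The covering weight at or below the vertex \<open>v\<close>: the covering
      words that extend \<open>v\<close>, \<open>v\<close> itself included.\<close>
    define F where "F = (\<lambda>v. \<Sum>n. if take (length v) (u n) = v then ennreal (wt (u n)) else 0)"
    have wt_snoc: "wt (v @ [w]) = wt v * r w powr s" if "v \<in> lists S" "w \<in> S" for v w
    proof -
      have "0 \<le> prod_list (map r v)"
        using that(1) by (induction v) (auto simp: r less_imp_le)
      then show ?thesis using r[of w] that by (auto simp: wt_def powr_mult)
    qed
    have "F [] < ennreal (wt [])"
    proof -
      have "F [] = (\<Sum>n. ennreal (wt (u n)))" by (simp add: F_def)
      also have "\<dots> \<le> (\<Sum>n. ennreal (1 / \<delta> powr s) * hausdorff_gauge s (U n) + ennreal ((1/2) ^ Suc (Suc n)))"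
      proof (intro suminf_le summableI)
        fix n
        have "ennreal (wt (u n)) \<le> ennreal ((diameter (U n) / \<delta>) powr s + (1/2) ^ Suc (Suc n))"
          by (intro ennreal_leI u)
        also have "\<dots> = ennreal ((diameter (U n) / \<delta>) powr s) + ennreal ((1/2) ^ Suc (Suc n))"
          by (intro ennreal_plus) auto
        also have "ennreal ((diameter (U n) / \<delta>) powr s)
            = ennreal (1 / \<delta> powr s) * ennreal (diameter (U n) powr s)"
          using \<open>\<delta> > 0\<close> diameter_ge_0[OF bdd[of n]]
          by (simp add: powr_divide flip: ennreal_mult)
        also have "ennreal (diameter (U n) powr s) = hausdorff_gauge s (U n)"
          using \<open>s > 0\<close> by (auto simp: hausdorff_gauge_def)
        finally show "ennreal (wt (u n)) \<le> ennreal (1 / \<delta> powr s) * hausdorff_gauge s (U n)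
            + ennreal ((1/2) ^ Suc (Suc n))" .
      qed
      also have "\<dots> = ennreal (1 / \<delta> powr s) * (\<Sum>n. hausdorff_gauge s (U n))
          + (\<Sum>n. ennreal ((1/2) ^ Suc (Suc n)))"
        by (simp add: suminf_add[OF summableI summableI, symmetric])
      also have "(\<Sum>n. ennreal ((1/2) ^ Suc (Suc n))) = ennreal (1/2)"
      proof -
        have "(\<lambda>n. (1/4) * (1/2) ^ n :: real) sums ((1/4) * (1 / (1 - 1/2)))"
          by (intro sums_mult geometric_sums) auto
        then have "(\<lambda>n. (1/2) ^ Suc (Suc n) :: real) sums (1/2)" by simp
        then show ?thesis by (intro suminf_ennreal_eq) auto
      qed
      also have "ennreal (1 / \<delta> powr s) * (\<Sum>n. hausdorff_gauge s (U n)) + ennreal (1/2)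
          < ennreal (1 / \<delta> powr s) * ennreal (\<delta> powr s / 2) + ennreal (1/2)"
        using small \<open>\<delta> > 0\<close>
        by (metis (no_types, lifting) add.commute divide_pos_pos ennreal_add_left_cancel_less
            ennreal_less_top ennreal_mult_strict_left_mono ennreal_zero_less_top
            ennreal_less_zero_iff infinity_ennreal_def less_irrefl powr_gt_zero top.not_eq_extremum zero_less_one)
      also have "\<dots> = ennreal (1 / \<delta> powr s * (\<delta> powr s / 2) + 1/2)"
        by (subst ennreal_mult[symmetric], simp, simp, subst ennreal_plus[symmetric], simp, simp, rule refl)
      also have "1 / \<delta> powr s * (\<delta> powr s / 2) + 1/2 = wt []"
        using \<open>\<delta> > 0\<close> by (simp add: wt_def)
      finally show ?thesis .
    qed
    moreover have step: "\<exists>w\<in>S. F (v @ [w]) < ennreal (wt (v @ [w]))"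
      if v: "v \<in> lists S" "F v < ennreal (wt v)" for v
    proof (rule ccontr)
      assume "\<not> ?thesis"
      then have *: "\<And>w. w \<in> S \<Longrightarrow> ennreal (wt (v @ [w])) \<le> F (v @ [w])" by force
      have wtnn: "0 \<le> wt v'" for v' by (simp add: wt_def)
      have "wt v * 1 \<le> wt v * (\<Sum>w\<in>S. r w powr s)"
        using wtnn by (intro mult_left_mono sum1) 
      then have "ennreal (wt v) \<le> ennreal (\<Sum>w\<in>S. wt (v @ [w]))"
        using v by (intro ennreal_leI) (simp add: sum_distrib_left wt_snoc)
      also have "\<dots> = (\<Sum>w\<in>S. ennreal (wt (v @ [w])))"
        using wtnn by simp
      also have "\<dots> \<le> (\<Sum>w\<in>S. F (v @ [w]))"
        using * by (rule sum_mono)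
      also have "\<dots> = (\<Sum>n. \<Sum>w\<in>S. if take (length (v @ [w])) (u n) = v @ [w] then ennreal (wt (u n)) else 0)"
        unfolding F_def by (subst suminf_sum) (auto intro: summableI)
      \<comment> \<open>A covering word extends at most one child of \<open>v\<close>, so each index
        contributes at most once.\<close>
      also have "\<dots> \<le> F v"
        unfolding F_def
      proof (intro suminf_le summableI)
        fix n
        show "(\<Sum>w\<in>S. if take (length (v @ [w])) (u n) = v @ [w] then ennreal (wt (u n)) else 0)
            \<le> (if take (length v) (u n) = v then ennreal (wt (u n)) else 0)" (is "?lhs \<le> ?rhs")
        proof (cases "\<exists>w\<in>S. take (length (v @ [w])) (u n) = v @ [w]")
          case True
          then obtain w1 where w1: "w1 \<in> S" "take (length (v @ [w1])) (u n) = v @ [w1]" by blast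
          have "?lhs = (\<Sum>w\<in>S. if w = w1 then ennreal (wt (u n)) else 0)"
            using w1 by (intro sum.cong) auto
          also have "\<dots> = ennreal (wt (u n))"
            using w1 \<open>finite S\<close> by simp
          moreover have "take (length v) (u n) = v"
            using arg_cong[OF w1(2), of "take (length v)"] by simp
          ultimately show ?thesis by simp
        next
          case False
          then have "?lhs = 0" by (intro sum.neutral) auto
          then show ?thesis by simp
        qed
      qed
      finally show False using v by simp
    qed
    have "\<exists>v. (v 0 = []) \<and> (\<forall>n. (v n \<in> lists S \<and> F (v n) < ennreal (wt (v n))) \<and> (\<exists>w\<in>S. v (Suc n) = v n @ [w]))"
    proof -
      define nx where "nx = (\<lambda>v. v @ [SOME w. w \<in> S \<and> F (v @ [w]) < ennreal (wt (v @ [w]))])"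
      have nx: "nx v \<in> lists S \<and> F (nx v) < ennreal (wt (nx v)) \<and> (\<exists>w\<in>S. nx v = v @ [w])"
        if "v \<in> lists S" "F v < ennreal (wt v)" for v
        unfolding nx_def using someI_ex[OF step[OF that, unfolded Bex_def]] that(1) by auto
      have "(nx ^^ n) [] \<in> lists S \<and> F ((nx ^^ n) []) < ennreal (wt ((nx ^^ n) []))" for n
        using calculation nx by (induction n) auto
      with nx show ?thesis by (intro exI[of _ "\<lambda>n. (nx ^^ n) []"]) auto
    qed
    then obtain v where v: "v 0 = []" "\<And>n. F (v n) < ennreal (wt (v n))"
        "\<And>n. \<exists>w\<in>S. v (Suc n) = v n @ [w]" by blast
    then obtain \<omega> where \<omega>: "\<And>n. \<omega> n \<in> S" "\<And>n. v (Suc n) = v n @ [\<omega> n]"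
      by metis
    have v\<omega>: "v n = map \<omega> [0..<n]" for n
      by (induction n) (auto simp: v(1) \<omega>(2))
    have "\<omega> \<in> UNIV \<rightarrow> S" using \<omega> by auto
    with xR cov obtain n where n: "x \<omega> \<in> U n" by blast
    define k where "k = length (u n)"
    have un: "u n = v k" using u(2)[OF \<open>\<omega> \<in> UNIV \<rightarrow> S\<close> n] v\<omega> by (simp add: k_def)
    \<comment> \<open>The word covering the branch is its own prefix \<open>v k\<close>, so it alone
      contributes \<open>wt (v k)\<close> to \<open>F (v k)\<close>, against the choice of the
      branch.\<close>
    have "ennreal (wt (u n)) \<le> F (v k)"
    proof -
      have "ennreal (wt (u n)) = (if take (length (v k)) (u n) = v k then ennreal (wt (u n)) else 0)"
        by (simp add: un)
      also have "\<dots> \<le> F (v k)"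
        unfolding F_def
        using sum_le_suminf[OF summableI, of "{n}" "\<lambda>n. if take (length (v k)) (u n) = v k then ennreal (wt (u n)) else 0"]
        by simp
      finally show ?thesis .
    qed
    with v(2)[of k] show False by (simp add: un)
  qed
  have "ennreal (\<delta> powr s / 2) \<le> hausdorff_content s 1 R"
    unfolding hausdorff_content_def by (intro INF_greatest low) auto
  also have "\<dots> \<le> hausdorff_measure s R"
    unfolding hausdorff_measure_def by (intro SUP_upper) auto
  finally show ?thesis
    using \<open>\<delta> > 0\<close> by (auto simp: ennreal_eq_0_iff)
qed

section \<open>Iterated function systems with bounded distortion\<close>

abbreviation words :: "nat \<Rightarrow> nat \<Rightarrow> nat list set" where
  "words m n \<equiv> {I \<in> lists {1..m}. length I = n}"

lemma finite_words: "finite A \<Longrightarrow> finite {I \<in> lists A. length I = n}"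
  using finite_lists_length_eq[of A n] by (simp add: lists_eq_set)

lemma diameter_le_of_dist_le:
  assumes "0 \<le> d" "\<And>x y. x \<in> S \<Longrightarrow> y \<in> S \<Longrightarrow> dist x y \<le> d"
  shows "diameter S \<le> d"
  using assms by (auto simp: diameter_def intro!: cSUP_least)

lemma separate_compact_compact:
  fixes S T :: "'a::metric_space set"
  assumes "compact S" "compact T" "S \<inter> T = {}"
  shows "\<exists>d>0. \<forall>x\<in>S. \<forall>y\<in>T. d \<le> dist x y"
proof (cases "S \<times> T = {}")
  case False
  have "continuous_on (S \<times> T) (\<lambda>z. dist (fst z) (snd z))"
    by (intro continuous_intros)
  from continuous_attains_inf[OF compact_Times[OF assms(1,2)] False this]
  obtain a b where ab: "a \<in> S" "b \<in> T" "\<And>x y. x \<in> S \<Longrightarrow> y \<in> T \<Longrightarrow> dist a b \<le> dist x y"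
    by auto
  with assms(3) have "0 < dist a b" by auto
  with ab show ?thesis by blast
qed (auto intro: exI[of _ 1])

lemma word_map_simps [simp]:
  "word_map \<psi> [] = id" "word_map \<psi> (i # I) = \<psi> i \<circ> word_map \<psi> I"
  by (simp_all add: word_map_def)

lemma word_map_append: "word_map \<psi> (I @ J) p = word_map \<psi> I (word_map \<psi> J p)"
  by (induction I) auto

lemma word_map_mem:
  assumes "open_set_condition m \<psi> V" "I \<in> lists {1..m}" "p \<in> V"
  shows "word_map \<psi> I p \<in> V"
  using assms(2,3)
proof (induction I)
  case (Cons i I)
  then have "\<psi> i ` V \<subseteq> V" "word_map \<psi> I p \<in> V"
    using assms(1) by (auto simp: open_set_condition_def)
  then show ?case by auto
qed simp

text \<open>The data of the projective system on which the dimension count runs.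
  \<open>\<rho>\<close> is attached to whole words because norms of products are not multiplicative;
  constants \<open>c\<close> and \<open>C\<close> that do not depend on the word take over the role
  of multiplicativity.\<close>

locale conformal_ifs =
  fixes m :: nat and \<psi> :: "nat \<Rightarrow> 'a::metric_space \<Rightarrow> 'a" and V :: "'a set"
    and \<rho> :: "nat list \<Rightarrow> real" and c C K L :: real
  assumes compact_UNIV: "compact (UNIV :: 'a set)"
    and open_V: "open V"
    and osc: "open_set_condition m \<psi> V"
    and ratio_pos: "I \<in> lists {1..m} \<Longrightarrow> 0 < \<rho> I"
    and ratio_decay: "I \<in> lists {1..m} \<Longrightarrow> \<rho> I \<le> K * L ^ length I"
    and L: "0 < L" "L < 1" and c: "0 < c" and C: "0 < C"
    and dist_lower: "I \<in> lists {1..m} \<Longrightarrow> p \<in> V \<Longrightarrow> q \<in> V \<Longrightarrow>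
      c * \<rho> I * dist p q \<le> dist (word_map \<psi> I p) (word_map \<psi> I q)"
    and dist_upper: "I \<in> lists {1..m} \<Longrightarrow> p \<in> V \<Longrightarrow> q \<in> V \<Longrightarrow>
      dist (word_map \<psi> I p) (word_map \<psi> I q) \<le> C * \<rho> I * dist p q"
begin

lemma K_pos: "0 < K"
  using ratio_pos[of "[]"] ratio_decay[of "[]"] by simp

lemmas word_map_in = word_map_mem[OF osc]

lemma word_map_inj: "I \<in> lists {1..m} \<Longrightarrow> p \<in> V \<Longrightarrow> q \<in> V \<Longrightarrow>
    word_map \<psi> I p = word_map \<psi> I q \<Longrightarrow> p = q"
  using dist_lower[of I p q] ratio_pos[of I] c by (auto simp: mult_le_0_iff)

text \<open>Letters are recovered from the left: disjointness of the images of \<open>V\<close>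
  fixes the leading letter, and the lower distance estimate lets it be cancelled.\<close>

lemma word_eqI:
  assumes "length I = length J" "I \<in> lists {1..m}" "J \<in> lists {1..m}" "p \<in> V" "q \<in> V"
    "word_map \<psi> I p = word_map \<psi> J q"
  shows "I = J"
  using assms
proof (induction I J rule: list_induct2)
  case (Cons i I j J)
  let ?p = "word_map \<psi> I p" and ?q = "word_map \<psi> J q"
  have pq: "?p \<in> V" "?q \<in> V" using Cons word_map_in by auto
  have eq: "\<psi> i ?p = \<psi> j ?q" using Cons by simp
  have "i = j"
  proof (rule ccontr)
    assume "i \<noteq> j"
    with osc Cons.prems have "\<psi> i ` V \<inter> \<psi> j ` V = {}"
      unfolding open_set_condition_def disjoint_family_on_def by auto
    with pq eq show False by (metis IntI empty_iff imageI)
  qed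
  moreover have "?p = ?q"
    using word_map_inj[of "[i]" ?p ?q] Cons.prems pq eq \<open>i = j\<close> by simp
  ultimately show ?case using Cons by simp
qed auto

section \<open>Level sums and convergence of the series over words\<close>

definition level_sum :: "real \<Rightarrow> nat \<Rightarrow> real" where
  "level_sum s n = (\<Sum>I\<in>words m n. \<rho> I powr s)"

lemma level_sum_nonneg: "0 \<le> level_sum s n"
  unfolding level_sum_def by (intro sum_nonneg) auto

lemma sum_level_sum:
  "(\<Sum>k<n. level_sum s k) = (\<Sum>I\<in>(\<Union>k<n. words m k). \<rho> I powr s)"
  unfolding level_sum_def by (rule sum.UNION_disjoint[symmetric]) (auto simp: finite_words)

lemma level_sum_tendsto_0:
  assumes "(\<Sum>\<^sub>\<infinity>I\<in>lists {1..m}. ennreal (\<rho> I powr s)) \<noteq> \<infinity>"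
  shows "level_sum s \<longlonglongrightarrow> 0"
proof -
  define B where "B = enn2real (\<Sum>\<^sub>\<infinity>I\<in>lists {1..m}. ennreal (\<rho> I powr s))"
  have B: "ennreal B = (\<Sum>\<^sub>\<infinity>I\<in>lists {1..m}. ennreal (\<rho> I powr s))"
    using assms by (simp add: B_def top.not_eq_extremum)
  have "(\<Sum>k<n. level_sum s k) \<le> B" for n
  proof -
    have "ennreal (\<Sum>k<n. level_sum s k) = (\<Sum>I\<in>(\<Union>k<n. words m k). ennreal (\<rho> I powr s))"
      unfolding sum_level_sum by simp
    also have "\<dots> \<le> ennreal B"
      unfolding B by (subst nonneg_infsum_complete) (auto simp: finite_words intro!: SUP_upper)
    finally show ?thesis by (simp add: B_def)
  qed
  then have "summable (level_sum s)"
    by (intro summableI_nonneg_bounded level_sum_nonneg)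
  then show ?thesis by (rule summable_LIMSEQ_zero)
qed

text \<open>Splitting \<open>\<rho> I powr t\<close> into the powers \<open>t - s\<close> and
  \<open>s\<close>, and bounding the first by the decay of the ratios, makes the level sums at
  \<open>t\<close> geometric. Read backwards, divergence at \<open>t\<close> makes the level sums at
  every smaller exponent unbounded; this is where the gap \<open>s < t\<close> is spent.\<close>

lemma infsum_finite_of_level_sum_bounded:
  assumes "s < t" and M: "\<And>n. level_sum s n \<le> M"
  shows "(\<Sum>\<^sub>\<infinity>I\<in>lists {1..m}. ennreal (\<rho> I powr t)) \<noteq> \<infinity>"
proof -
  define l where "l = L powr (t - s)"
  have l: "0 < l" "l < 1" using L assms(1) by (auto simp: l_def powr01_less_one)
  have M0: "0 \<le> M" using M[of 0] level_sum_nonneg[of s 0] by linarith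
  have lev: "level_sum t n \<le> M * K powr (t - s) * l ^ n" for n
  proof -
    have "level_sum t n \<le> (\<Sum>I\<in>words m n. (K * L ^ n) powr (t - s) * \<rho> I powr s)"
      unfolding level_sum_def
    proof (rule sum_mono)
      fix I assume I: "I \<in> words m n"
      have "\<rho> I powr t = \<rho> I powr (t - s) * \<rho> I powr s"
        by (simp flip: powr_add)
      also have "\<dots> \<le> (K * L ^ n) powr (t - s) * \<rho> I powr s"
        using I ratio_pos[of I] ratio_decay[of I] assms(1)
        by (intro mult_right_mono powr_mono2) auto
      finally show "\<rho> I powr t \<le> (K * L ^ n) powr (t - s) * \<rho> I powr s" .
    qed
    also have "\<dots> = (K * L ^ n) powr (t - s) * level_sum s n"
      by (simp add: level_sum_def sum_distrib_left)
    also have "\<dots> \<le> (K * L ^ n) powr (t - s) * M"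
      by (intro mult_left_mono M) auto
    also have "(K * L ^ n) powr (t - s) = K powr (t - s) * l ^ n"
    proof -
      have "(L ^ n) powr (t - s) = l ^ n"
        using L by (simp add: l_def powr_powr powr_power mult.commute flip: powr_realpow)
      then show ?thesis using L K_pos by (simp add: powr_mult)
    qed
    finally show ?thesis by (simp add: mult_ac)
  qed
  define T where "T = M * K powr (t - s) * (1 / (1 - l))"
  have fin: "(\<Sum>I\<in>F. ennreal (\<rho> I powr t)) \<le> ennreal T" if F: "finite F" "F \<subseteq> lists {1..m}" for F
  proof -
    \<comment> \<open>The levels \<open>k < n\<close> must reach the longest word of
      \<open>F\<close>, hence \<open>Suc\<close>; the inserted 0 serves the empty
      \<open>F\<close>.\<close>
    define n where "n = Suc (Max (insert 0 (length ` F)))"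
    have sub: "F \<subseteq> (\<Union>k<n. words m k)"
    proof
      fix I assume "I \<in> F"
      then have "length I < n" using F(1) by (auto simp: n_def less_Suc_eq_le intro!: Max_ge)
      with \<open>I \<in> F\<close> F(2) show "I \<in> (\<Union>k<n. words m k)" by blast
    qed
    have "(\<Sum>I\<in>F. \<rho> I powr t) \<le> (\<Sum>k<n. level_sum t k)"
      unfolding sum_level_sum by (rule sum_mono2) (use sub in \<open>auto simp: finite_words\<close>)
    also have "\<dots> \<le> (\<Sum>k<n. M * K powr (t - s) * l ^ k)"
      by (intro sum_mono lev)
    also have "\<dots> = M * K powr (t - s) * (\<Sum>k<n. l ^ k)"
      by (simp add: sum_distrib_left)
    also have "(\<Sum>k<n. l ^ k) \<le> (\<Sum>k. l ^ k)"
      using l by (intro sum_le_suminf summable_geometric) auto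
    also have "(\<Sum>k. l ^ k) = 1 / (1 - l)"
      using l by (intro suminf_geometric) auto
    finally have "(\<Sum>I\<in>F. \<rho> I powr t) \<le> T"
      using M0 by (simp add: T_def mult_left_mono)
    then have "ennreal (\<Sum>I\<in>F. \<rho> I powr t) \<le> ennreal T" by (rule ennreal_leI)
    then show ?thesis by simp
  qed
  have "(\<Sum>\<^sub>\<infinity>I\<in>lists {1..m}. ennreal (\<rho> I powr t)) \<le> ennreal T"
    by (subst nonneg_infsum_complete, simp, intro SUP_least fin) simp_all
  then show ?thesis
    using ennreal_less_top[of T] by (auto simp: top_unique)
qed

section \<open>Vanishing measure where the series converges\<close>

lemma residual_setD:
  assumes "x \<in> residual_set m \<psi> V" "n \<ge> 1"
  shows "\<exists>I\<in>words m n. \<exists>p\<in>V. x = word_map \<psi> I p"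
  using assms unfolding residual_set_def by blast

lemma hausdorff_measure_residual_set_eq_0:
  assumes "s > 0" and fin: "(\<Sum>\<^sub>\<infinity>I\<in>lists {1..m}. ennreal (\<rho> I powr s)) \<noteq> \<infinity>"
  shows "hausdorff_measure s (residual_set m \<psi> V) = 0"
proof -
  define D where "D = diameter (UNIV :: 'a set)"
  have bdd: "bounded (UNIV :: 'a set)" using compact_UNIV by (rule compact_imp_bounded)
  have D: "dist p q \<le> D" "0 \<le> D" for p q :: 'a
    unfolding D_def by (auto intro: diameter_bounded_bound[OF bdd] diameter_ge_0[OF bdd])
  have diam: "diameter (word_map \<psi> I ` V) \<le> C * \<rho> I * D" if "I \<in> lists {1..m}" for I
  proof (rule diameter_le_of_dist_le)
    show "0 \<le> C * \<rho> I * D"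
      using C D ratio_pos[OF that] by simp
    fix x y assume "x \<in> word_map \<psi> I ` V" "y \<in> word_map \<psi> I ` V"
    then obtain p q where pq: "p \<in> V" "q \<in> V" "x = word_map \<psi> I p" "y = word_map \<psi> I q" by auto
    then have "dist x y \<le> C * \<rho> I * dist p q" using dist_upper[OF that] by simp
    also have "\<dots> \<le> C * \<rho> I * D" using C D ratio_pos[OF that] by (intro mult_left_mono) auto
    finally show "dist x y \<le> C * \<rho> I * D" .
  qed
  have "hausdorff_content s \<delta> (residual_set m \<psi> V) = 0" if "\<delta> > 0" for \<delta>
  proof -
    have "(\<lambda>n. C * (K * L ^ n) * D) \<longlonglongrightarrow> C * (K * 0) * D"
      using L by (intro tendsto_intros LIMSEQ_power_zero) auto
    then have "eventually (\<lambda>n. C * (K * L ^ n) * D < \<delta>) sequentially"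
      using \<open>\<delta> > 0\<close> by (intro order_tendstoD) auto
    then have ev: "eventually (\<lambda>n. n \<ge> 1 \<and> C * (K * L ^ n) * D < \<delta>) sequentially"
      using eventually_ge_at_top by (rule eventually_conj[rotated])
    have bound: "hausdorff_content s \<delta> (residual_set m \<psi> V) \<le> ennreal ((C * D) powr s * level_sum s n)"
      if n: "n \<ge> 1" "C * (K * L ^ n) * D < \<delta>" for n
    proof -
      \<comment> \<open>Covers are indexed by \<open>nat\<close>. A number outside the range of
        \<open>to_nat\<close> decodes to an unspecified word; the second condition gives it the
        empty set, so that each word occurs once.\<close>
      define U where "U = (\<lambda>k. if from_nat k \<in> words m n \<and> to_nat (from_nat k :: nat list) = k
        then word_map \<psi> (from_nat k) ` V else {})"
      have U: "U (to_nat I) = (if I \<in> words m n then word_map \<psi> I ` V else {})" for I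
        by (simp add: U_def)
      have U0: "U k = {}" if "k \<notin> to_nat ` words m n" for k
        using that by (auto simp: U_def intro: rev_image_eqI)
      have "(\<Sum>k. hausdorff_gauge s (U k)) = (\<Sum>k\<in>to_nat ` words m n. hausdorff_gauge s (U k))"
        by (rule suminf_finite) (auto simp: finite_words U0 hausdorff_gauge_def)
      also have "\<dots> = (\<Sum>I\<in>words m n. hausdorff_gauge s (U (to_nat I)))"
        by (subst sum.reindex) auto
      also have "\<dots> \<le> (\<Sum>I\<in>words m n. ennreal ((C * D) powr s * \<rho> I powr s))"
      proof (rule sum_mono)
        fix I assume I: "I \<in> words m n"
        have "diameter (word_map \<psi> I ` V) powr s \<le> (C * \<rho> I * D) powr s"
          using I \<open>s > 0\<close>
          by (intro powr_mono2 diam diameter_ge_0 bounded_subset[OF bdd]) auto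
        also have "\<dots> = (C * D) powr s * \<rho> I powr s"
          using C D ratio_pos[of I] I by (simp add: powr_mult mult_ac)
        finally show "hausdorff_gauge s (U (to_nat I)) \<le> ennreal ((C * D) powr s * \<rho> I powr s)"
          using \<open>s > 0\<close> I by (auto simp: hausdorff_gauge_def U intro: ennreal_leI)
      qed
      also have "\<dots> = ennreal ((C * D) powr s * level_sum s n)"
        by (simp add: level_sum_def sum_distrib_left)
      finally have le: "(\<Sum>k. hausdorff_gauge s (U k)) \<le> ennreal ((C * D) powr s * level_sum s n)" .
      have "residual_set m \<psi> V \<subseteq> (\<Union>k. U k)"
      proof
        fix x assume "x \<in> residual_set m \<psi> V"
        then obtain I p where "I \<in> words m n" "p \<in> V" "x = word_map \<psi> I p"
          using residual_setD n by blast
        then have "x \<in> U (to_nat I)" by (auto simp: U)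
        then show "x \<in> (\<Union>k. U k)" by blast
      qed
      moreover have "bounded (U k) \<and> diameter (U k) \<le> \<delta>" for k
      proof (cases "k \<in> to_nat ` words m n")
        case True
        then obtain I where I: "I \<in> words m n" "k = to_nat I" by auto
        have "diameter (word_map \<psi> I ` V) \<le> C * \<rho> I * D" using diam I by auto
        also have "\<dots> \<le> C * (K * L ^ n) * D"
          using I C D ratio_decay[of I] by (intro mult_right_mono mult_left_mono) auto
        finally show ?thesis using I n bounded_subset[OF bdd] by (auto simp: U)
      qed (use U0 \<open>\<delta> > 0\<close> in auto)
      ultimately have "hausdorff_content s \<delta> (residual_set m \<psi> V) \<le> (\<Sum>k. hausdorff_gauge s (U k))"
        unfolding hausdorff_content_def by (intro INF_lower) auto
      with le show ?thesis by order
    qed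
    have "(\<lambda>n. ennreal ((C * D) powr s * level_sum s n)) \<longlonglongrightarrow> ennreal ((C * D) powr s * 0)"
      by (intro tendsto_intros tendsto_ennrealI level_sum_tendsto_0 fin)
    then have "hausdorff_content s \<delta> (residual_set m \<psi> V) \<le> ennreal ((C * D) powr s * 0)"
      by (rule tendsto_lowerbound) (auto intro: eventually_mono[OF ev] bound)
    then show ?thesis by simp
  qed
  then show ?thesis by (simp add: hausdorff_measure_def)
qed

section \<open>Positive measure below an exponent of divergence\<close>

lemma finite_family_compact_separated:
  assumes "finite S" "S \<subseteq> lists {1..m}" "B \<subseteq> V" "compact B"
    and len: "\<And>I. I \<in> S \<Longrightarrow> length I = n"
  shows "\<exists>\<delta>>0. \<forall>I\<in>S. \<forall>J\<in>S. I \<noteq> J \<longrightarrow> (\<forall>p\<in>B. \<forall>q\<in>B. \<delta> \<le> dist (word_map \<psi> I p) (word_map \<psi> J q))"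
proof -
  have comp: "compact (word_map \<psi> I ` B)" if "I \<in> S" for I
  proof (rule compact_continuous_image[OF _ \<open>compact B\<close>])
    have "(C * \<rho> I)-lipschitz_on B (word_map \<psi> I)"
      using that assms dist_upper[of I] ratio_pos[of I] C
      by (intro lipschitz_onI) (auto simp: less_imp_le subset_iff)
    then show "continuous_on B (word_map \<psi> I)" by (rule lipschitz_on_continuous_on)
  qed
  have ex: "\<exists>d. 0 < d \<and> (\<forall>p\<in>B. \<forall>q\<in>B. d \<le> dist (word_map \<psi> I p) (word_map \<psi> J q))"
    if IJ: "I \<in> S" "J \<in> S" "I \<noteq> J" for I J
  proof -
    \<comment> \<open>Words of equal length whose images of \<open>V\<close> meet coincide, and
      \<open>B\<close> lies in \<open>V\<close>. So the images of \<open>B\<close> are disjoint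
      compact sets and keep a positive distance.\<close>
    have "word_map \<psi> I ` B \<inter> word_map \<psi> J ` B = {}"
    proof (rule ccontr)
      assume "\<not> ?thesis"
      then obtain p q where "p \<in> B" "q \<in> B" "word_map \<psi> I p = word_map \<psi> J q" by auto
      moreover have "I \<in> lists {1..m}" "J \<in> lists {1..m}" "length I = length J"
        using IJ assms(2) len by blast+
      ultimately show False
        using IJ(3) assms(3) word_eqI[of I J p q] by blast
    qed
    from separate_compact_compact[OF comp[OF IJ(1)] comp[OF IJ(2)] this] show ?thesis
      by (simp only: ball_simps)
  qed
  define d where "d = (\<lambda>I J. SOME d. 0 < d \<and>
    (\<forall>p\<in>B. \<forall>q\<in>B. d \<le> dist (word_map \<psi> I p) (word_map \<psi> J q)))"
  have d: "0 < d I J \<and> (\<forall>p\<in>B. \<forall>q\<in>B. d I J \<le> dist (word_map \<psi> I p) (word_map \<psi> J q))"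
    if "I \<in> S" "J \<in> S" "I \<noteq> J" for I J
    unfolding d_def by (rule someI_ex) (rule ex[OF that])
  \<comment> \<open>The inserted 1 keeps the minimum defined when \<open>S\<close> has no two
    distinct words.\<close>
  define X where "X = insert 1 ((\<lambda>(I, J). d I J) ` {(I, J) \<in> S \<times> S. I \<noteq> J})"
  have "finite {(I, J) \<in> S \<times> S. I \<noteq> J}"
    by (rule finite_subset[of _ "S \<times> S"]) (use \<open>finite S\<close> in auto)
  then have "finite X" by (simp add: X_def)
  show ?thesis
  proof (intro exI[of _ "Min X"] conjI ballI impI)
    show "0 < Min X" using \<open>finite X\<close> d by (subst Min_gr_iff) (auto simp: X_def)
    fix I J p q assume *: "I \<in> S" "J \<in> S" "I \<noteq> J" "p \<in> B" "q \<in> B"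
    have "Min X \<le> d I J" using * \<open>finite X\<close> by (intro Min_le) (auto simp: X_def)
    also have "\<dots> \<le> dist (word_map \<psi> I p) (word_map \<psi> J q)" using d * by blast
    finally show "Min X \<le> dist (word_map \<psi> I p) (word_map \<psi> J q)" .
  qed
qed

text \<open>
  A point of the residual set gives a word \<open>J\<close> mapping \<open>V\<close> into a closed ball inside \<open>V\<close>.
  Prefixing every letter of a subsystem with \<open>J\<close> makes its first-level images separated compact
  sets and keeps its limit points in the residual set.
\<close>

lemma hausdorff_measure_residual_set_neq_0:
  assumes "0 \<le> s" "s < t" and R: "residual_set m \<psi> V \<noteq> {}"
    and inf: "(\<Sum>\<^sub>\<infinity>I\<in>lists {1..m}. ennreal (\<rho> I powr t)) = \<infinity>"
  shows "hausdorff_measure s (residual_set m \<psi> V) \<noteq> 0"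
proof (cases "s = 0")
  case True
  \<comment> \<open>At exponent 0 the gauge of a nonempty set is 1, and a cover of a nonempty set
    has a nonempty member.\<close>
  have "1 \<le> (\<Sum>n. hausdorff_gauge s (U n))" if "residual_set m \<psi> V \<subseteq> (\<Union>n. U n)" for U :: "nat \<Rightarrow> 'a set"
  proof -
    have "(\<Union>n. U n) \<noteq> {}" using R that by (metis subset_empty)
    then obtain n where "U n \<noteq> {}" by blast
    then have "1 = (\<Sum>k\<in>{n}. hausdorff_gauge s (U k))" by (simp add: hausdorff_gauge_def True)
    also have "\<dots> \<le> (\<Sum>n. hausdorff_gauge s (U n))" by (intro sum_le_suminf summableI) auto
    finally show ?thesis .
  qed
  then have "1 \<le> hausdorff_content s 1 (residual_set m \<psi> V)"
    unfolding hausdorff_content_def by (intro INF_greatest) auto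
  also have "\<dots> \<le> hausdorff_measure s (residual_set m \<psi> V)"
    unfolding hausdorff_measure_def by (intro SUP_upper) auto
  finally show ?thesis by auto
next
  case False
  with \<open>0 \<le> s\<close> have "s > 0" by simp
  define D where "D = diameter (UNIV :: 'a set)"
  have bdd: "bounded (UNIV :: 'a set)" using compact_UNIV by (rule compact_imp_bounded)
  have D: "dist p q \<le> D" "0 \<le> D" for p q :: 'a
    unfolding D_def by (auto intro: diameter_bounded_bound[OF bdd] diameter_ge_0[OF bdd])
  obtain x0 where x0: "x0 \<in> residual_set m \<psi> V" using R by blast
  then have "x0 \<in> V" using residual_setD[of x0 1] word_map_in by auto
  then obtain e where e: "e > 0" "cball x0 e \<subseteq> V" using open_V open_contains_cball by blast
  define B where "B = cball x0 e"
  have B: "B \<subseteq> V" "compact B" "x0 \<in> B"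
    using e compact_Int_closed[OF compact_UNIV, of B] by (auto simp: B_def)
  \<comment> \<open>The second condition keeps the image of \<open>V\<close> under a word of length
    \<open>n0\<close> inside \<open>B\<close> as soon as it contains \<open>x0\<close>; the third
    makes the ratios \<open>r I\<close> below at most 1/2, with \<open>K\<close> as a bound for
    \<open>\<rho> I\<close>.\<close>
  obtain n0 where n0: "n0 \<ge> 1" "C * (K * L ^ n0) * D < e" "c * (K * L ^ n0) * (c * K) < 1/2"
  proof -
    have "(\<lambda>n. C * (K * L ^ n) * D) \<longlonglongrightarrow> C * (K * 0) * D"
      using L by (intro tendsto_intros LIMSEQ_power_zero) auto
    then have 1: "eventually (\<lambda>n. C * (K * L ^ n) * D < e) sequentially"
      using \<open>e > 0\<close> by (intro order_tendstoD) auto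
    have "(\<lambda>n. c * (K * L ^ n) * (c * K)) \<longlonglongrightarrow> c * (K * 0) * (c * K)"
      using L by (intro tendsto_intros LIMSEQ_power_zero) auto
    then have 2: "eventually (\<lambda>n. c * (K * L ^ n) * (c * K) < 1/2) sequentially"
      by (intro order_tendstoD) auto
    have "eventually (\<lambda>n. n \<ge> 1 \<and> C * (K * L ^ n) * D < e \<and> c * (K * L ^ n) * (c * K) < 1/2) sequentially"
      by (intro eventually_conj 1 2 eventually_ge_at_top)
    then show ?thesis using that eventually_happens trivial_limit_sequentially by blast
  qed
  obtain J q0 where J: "J \<in> words m n0" "q0 \<in> V" "x0 = word_map \<psi> J q0"
    using residual_setD[OF x0 n0(1)] by blast
  have JB: "word_map \<psi> J p \<in> B" if "p \<in> V" for p
  proof -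
    have "dist x0 (word_map \<psi> J p) \<le> C * \<rho> J * dist q0 p"
      using J that dist_upper by auto
    also have "\<dots> \<le> C * (K * L ^ n0) * D"
      using J C D ratio_decay[of J] ratio_pos[of J] K_pos L
      by (intro mult_mono mult_left_mono) (auto simp: less_imp_le)
    finally show ?thesis using n0 by (simp add: B_def)
  qed
  \<comment> \<open>Two uses of \<open>dist_lower\<close>, for \<open>I\<close> and then for
    \<open>J\<close>: a block \<open>J @ I\<close> shrinks distances in \<open>V\<close> by no more
    than this factor.\<close>
  define r where "r = (\<lambda>I. c * \<rho> J * (c * \<rho> I))"
  have \<rho>J: "0 < \<rho> J" using J ratio_pos by auto
  \<comment> \<open>If all level sums stayed below this constant, the series at \<open>t\<close>
    would converge. The constant is chosen so that the numbers \<open>r I powr s\<close> add up to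
    at least 1.\<close>
  obtain n where n: "1 / (c * \<rho> J * c) powr s \<le> level_sum s n"
  proof (rule ccontr)
    assume "\<not> thesis"
    then have "level_sum s n \<le> 1 / (c * \<rho> J * c) powr s" for n using that by (meson linear)
    from infsum_finite_of_level_sum_bounded[OF \<open>s < t\<close> this] inf show False by simp
  qed
  define S where "S = words m n"
  have Sl: "I \<in> S \<Longrightarrow> I \<in> lists {1..m}" "I \<in> S \<Longrightarrow> length I = n" for I by (auto simp: S_def)
  have "finite S" by (simp add: S_def finite_words)
  have r: "0 < r I \<and> r I \<le> 1/2" if "I \<in> S" for I
  proof
    have I: "0 < \<rho> I" "\<rho> I \<le> K"
    proof -
      have "\<rho> I \<le> K * L ^ length I" using ratio_decay Sl that by blast
      also have "\<dots> \<le> K * 1" using K_pos L by (intro mult_left_mono power_le_one) auto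
      finally show "\<rho> I \<le> K" by simp
    qed (use that Sl ratio_pos in auto)
    show "0 < r I" using I c \<rho>J by (simp add: r_def)
    have "r I \<le> c * (K * L ^ n0) * (c * K)"
      unfolding r_def using I c \<rho>J J ratio_decay[of J] K_pos L
      by (intro mult_mono mult_left_mono) auto
    with n0 show "r I \<le> 1/2" by linarith
  qed
  have sum1: "1 \<le> (\<Sum>I\<in>S. r I powr s)"
  proof -
    have "(\<Sum>I\<in>S. r I powr s) = (\<Sum>I\<in>S. (c * \<rho> J * c) powr s * \<rho> I powr s)"
      using c \<rho>J Sl ratio_pos
      by (intro sum.cong refl) (auto simp: r_def mult.assoc powr_mult[symmetric] less_imp_le)
    also have "\<dots> = (c * \<rho> J * c) powr s * level_sum s n"
      by (simp add: S_def level_sum_def sum_distrib_left)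
    finally show ?thesis using n c \<rho>J by (simp add: divide_le_eq mult.commute)
  qed
  \<comment> \<open>A branch is a sequence of blocks \<open>J @ I\<close>; \<open>H u\<close>
    composes the blocks of \<open>u\<close>, the leftmost outermost.\<close>
  define H where "H = (\<lambda>u. word_map \<psi> (concat (map (\<lambda>I. J @ I) u)))"
  have H_snoc: "H (u @ [I]) p = H u (word_map \<psi> J (word_map \<psi> I p))" for u I p
    by (simp add: H_def word_map_append)
  have lists: "concat (map (\<lambda>I. J @ I) u) \<in> lists {1..m}" if "u \<in> lists S" for u
    using that J Sl by (induction u) auto
  have HV: "H u p \<in> V" if "u \<in> lists S" "p \<in> V" for u p
    unfolding H_def using lists that word_map_in by blast
  have H_low: "prod_list (map r u) * dist p q \<le> dist (H u p) (H u q)"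
    if "u \<in> lists S" "p \<in> V" "q \<in> V" for u p q
    using that(1)
  proof (induction u)
    case Nil
    then show ?case by (simp add: H_def)
  next
    case (Cons I u)
    have I: "I \<in> lists {1..m}" "0 < \<rho> I" using Cons Sl ratio_pos by auto
    have pq: "H u p \<in> V" "H u q \<in> V" using HV that Cons by auto
    have "prod_list (map r (I # u)) * dist p q = r I * (prod_list (map r u) * dist p q)" by simp
    also have "\<dots> \<le> r I * dist (H u p) (H u q)"
      using Cons r[of I] by (intro mult_left_mono) auto
    also have "\<dots> = c * \<rho> J * (c * \<rho> I * dist (H u p) (H u q))" by (simp add: r_def)
    also have "\<dots> \<le> c * \<rho> J * dist (word_map \<psi> I (H u p)) (word_map \<psi> I (H u q))"
      using c \<rho>J I pq by (intro mult_left_mono dist_lower) auto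
    also have "\<dots> \<le> dist (word_map \<psi> J (word_map \<psi> I (H u p))) (word_map \<psi> J (word_map \<psi> I (H u q)))"
      using J I pq by (intro dist_lower word_map_in) auto
    also have "\<dots> = dist (H (I # u) p) (H (I # u) q)"
      by (simp add: H_def word_map_append)
    finally show ?case .
  qed
  obtain \<delta>0 where \<delta>0: "\<delta>0 > 0" "\<And>I I' p q. I \<in> S \<Longrightarrow> I' \<in> S \<Longrightarrow> I \<noteq> I' \<Longrightarrow> p \<in> B \<Longrightarrow> q \<in> B \<Longrightarrow>
      \<delta>0 \<le> dist (word_map \<psi> I p) (word_map \<psi> I' q)"
  proof -
    have "S \<subseteq> lists {1..m}" using Sl by blast
    from finite_family_compact_separated[OF \<open>finite S\<close> this B(1,2) Sl(2)] that show ?thesis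
      by blast
  qed
  define \<delta> where "\<delta> = c * \<rho> J * \<delta>0"
  have "\<delta> > 0" using \<delta>0 c \<rho>J by (simp add: \<delta>_def)
  \<comment> \<open>Compact and decreasing in \<open>k\<close>, since every further block maps
    \<open>B\<close> into itself; a common point of these sets serves as the limit point of the
    branch.\<close>
  define A where "A = (\<lambda>\<omega> k. H (map \<omega> [0..<k]) ` B)"
  have "\<exists>x. \<forall>k. x \<in> A \<omega> k" if \<omega>: "\<omega> \<in> UNIV \<rightarrow> S" for \<omega>
  proof -
    have mem: "map \<omega> [0..<k] \<in> lists S" for k using \<omega> by (auto simp: Pi_iff)
    have comp: "compact (A \<omega> k)" for k
      unfolding A_def
    proof (rule compact_continuous_image[OF _ \<open>compact B\<close>])
      let ?I = "concat (map (\<lambda>I. J @ I) (map \<omega> [0..<k]))"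
      have "(C * \<rho> ?I)-lipschitz_on B (word_map \<psi> ?I)"
        using dist_upper[OF lists[OF mem, of k]] ratio_pos[OF lists[OF mem, of k]] C B
        by (intro lipschitz_onI) (auto simp: less_imp_le subset_iff)
      then show "continuous_on B (H (map \<omega> [0..<k]))"
        unfolding H_def by (rule lipschitz_on_continuous_on)
    qed
    have "A \<omega> (Suc k) \<subseteq> A \<omega> k" for k
    proof -
      have "\<omega> k \<in> lists {1..m}" using \<omega> Sl by (auto simp: Pi_iff)
      then have "word_map \<psi> J (word_map \<psi> (\<omega> k) p) \<in> B" if "p \<in> B" for p
        using B that by (intro JB word_map_in) auto
      then show ?thesis by (auto simp: A_def H_snoc)
    qed
    then have dec: "A \<omega> l \<subseteq> A \<omega> k" if "k \<le> l" for k l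
      using that by (rule lift_Suc_antimono_le)
    have "UNIV \<inter> \<Inter> (A \<omega> ` UNIV) \<noteq> {}"
    proof (rule compact_imp_fip_image[OF compact_UNIV])
      fix I' :: "nat set" assume "finite I'"
      then have "A \<omega> (Max (insert 0 I')) \<subseteq> A \<omega> k" if "k \<in> I'" for k
        using that by (intro dec Max_ge) auto
      moreover have "A \<omega> (Max (insert 0 I')) \<noteq> {}" using B by (auto simp: A_def)
      ultimately show "UNIV \<inter> \<Inter> (A \<omega> ` I') \<noteq> {}" by blast
    qed (use comp compact_imp_closed in auto)
    then show ?thesis by auto
  qed
  then obtain x where x: "\<And>\<omega> k. \<omega> \<in> UNIV \<rightarrow> S \<Longrightarrow> x \<omega> \<in> A \<omega> k" by metis
  show ?thesis
  proof (rule hausdorff_measure_pos_of_separated_tree[OF \<open>finite S\<close> r \<open>s > 0\<close> sum1 \<open>\<delta> > 0\<close>])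
    fix \<omega> \<tau> :: "nat \<Rightarrow> nat list" and k
    assume \<omega>: "\<omega> \<in> UNIV \<rightarrow> S" and \<tau>: "\<tau> \<in> UNIV \<rightarrow> S"
      and eq: "\<And>j. j < k \<Longrightarrow> \<omega> j = \<tau> j" and ne: "\<omega> k \<noteq> \<tau> k"
    define u where "u = map \<omega> [0..<k]"
    have u: "u \<in> lists S" "u = map \<tau> [0..<k]" using \<omega> \<tau> eq by (auto simp: u_def Pi_iff)
    obtain p where p: "p \<in> B" "x \<omega> = H u (word_map \<psi> J (word_map \<psi> (\<omega> k) p))"
      using x[OF \<omega>, of "Suc k"] by (auto simp: A_def H_snoc simp flip: u_def)
    obtain q where q: "q \<in> B" "x \<tau> = H u (word_map \<psi> J (word_map \<psi> (\<tau> k) q))"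
      using x[OF \<tau>, of "Suc k"] by (auto simp: A_def H_snoc simp flip: u(2))
    have I: "\<omega> k \<in> S" "\<tau> k \<in> S" using \<omega> \<tau> by (auto simp: Pi_iff)
    have pq: "word_map \<psi> (\<omega> k) p \<in> V" "word_map \<psi> (\<tau> k) q \<in> V"
      using p q B I Sl word_map_in by auto
    have nn: "0 \<le> prod_list (map r u)"
      using u(1) by (induction u) (auto simp: r less_imp_le)
    have "(\<Prod>j<k. r (\<omega> j)) = prod_list (map r u)"
      unfolding u_def by (induction k) (auto simp: mult.commute)
    then have "\<delta> * (\<Prod>j<k. r (\<omega> j)) = prod_list (map r u) * (c * \<rho> J * \<delta>0)"
      by (simp add: \<delta>_def)
    also have "\<dots> \<le> prod_list (map r u) * (c * \<rho> J * dist (word_map \<psi> (\<omega> k) p) (word_map \<psi> (\<tau> k) q))"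
      using \<delta>0(2)[OF I ne p(1) q(1)] c \<rho>J nn by (intro mult_left_mono) auto
    also have "\<dots> \<le> prod_list (map r u) *
        dist (word_map \<psi> J (word_map \<psi> (\<omega> k) p)) (word_map \<psi> J (word_map \<psi> (\<tau> k) q))"
      using J pq nn by (intro mult_left_mono dist_lower) auto
    also have "\<dots> \<le> dist (x \<omega>) (x \<tau>)"
      unfolding p(2) q(2) using J by (intro H_low u(1) word_map_in[OF _ pq(1)] word_map_in[OF _ pq(2)]) auto
    finally show "\<delta> * (\<Prod>j<k. r (\<omega> j)) \<le> dist (x \<omega>) (x \<tau>)" .
  next
    fix \<omega> :: "nat \<Rightarrow> nat list" assume \<omega>: "\<omega> \<in> UNIV \<rightarrow> S"
    have "\<exists>I\<in>words m k. x \<omega> \<in> word_map \<psi> I ` V" for k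
    proof -
      define W where "W = concat (map (\<lambda>I. J @ I) (map \<omega> [0..<k]))"
      have W: "W \<in> lists {1..m}" unfolding W_def using \<omega> by (intro lists) (auto simp: Pi_iff)
      \<comment> \<open>Each block contains \<open>J\<close>, whose length \<open>n0\<close> is at
        least 1, so \<open>k\<close> blocks spell at least \<open>k\<close> letters and the word can
        be cut after the first \<open>k\<close>.\<close>
      have "k \<le> length W"
        unfolding W_def using J n0(1) by (induction k) auto
      obtain p where p: "p \<in> B" "x \<omega> = word_map \<psi> W p"
        using x[OF \<omega>, of k] by (auto simp: A_def H_def W_def)
      have td: "take k W \<in> lists {1..m}" "drop k W \<in> lists {1..m}"
        using W by (metis append_in_lists_conv append_take_drop_id)+
      have "x \<omega> = word_map \<psi> (take k W) (word_map \<psi> (drop k W) p)"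
        using p by (simp flip: word_map_append)
      moreover have "word_map \<psi> (drop k W) p \<in> V"
        using td p B by (intro word_map_in) auto
      ultimately show ?thesis
        using td \<open>k \<le> length W\<close> by (intro bexI[of _ "take k W"]) auto
    qed
    then show "x \<omega> \<in> residual_set m \<psi> V" unfolding residual_set_def by blast
  qed
qed

text \<open>One letter gives one word of each length, so the level sums at exponent 0 are bounded by
  1. This settles the case of a single map, where the residual set may be empty.\<close>

lemma infsum_single_map_finite:
  assumes "m = 1" "0 < t"
  shows "(\<Sum>\<^sub>\<infinity>I\<in>lists {1..m}. ennreal (\<rho> I powr t)) \<noteq> \<infinity>"
proof (rule infsum_finite_of_level_sum_bounded[OF \<open>0 < t\<close>])
  fix n
  have "level_sum 0 n \<le> real (card (words m n))"
    unfolding level_sum_def by (rule order_trans[OF sum_bounded_above[where K = 1]]) simp_all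
  also have "card (words m n) = 1"
    using card_lists_length_eq[of "{1..m}" n] assms(1) by (simp add: lists_eq_set)
  finally show "level_sum 0 n \<le> 1" by simp
qed

lemma hausdorff_dim_residual_set:
  assumes "m \<ge> 1" and R: "m \<ge> 2 \<Longrightarrow> residual_set m \<psi> V \<noteq> {}"
  shows "hausdorff_dim (residual_set m \<psi> V) =
    (SUP s\<in>{s. 0 \<le> s \<and> (\<Sum>\<^sub>\<infinity>I\<in>lists {1..m}. ennreal (\<rho> I powr s)) = \<infinity>}. ennreal s)"
    (is "?dim = ?sup")
proof (rule antisym)
  show "?dim \<le> ?sup"
  proof (rule ccontr)
    assume "\<not> ?thesis"
    then have "?sup < ?dim" by (rule not_le_imp_less)
    then obtain x where x: "?sup < x" "x < ?dim" using dense by blast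
    then obtain s where s: "x = ennreal s" "0 \<le> s" by (cases x) auto
    have "s \<noteq> 0" using x(1) s(1) by auto
    with s(2) have "0 < s" by simp
    have "hausdorff_measure s (residual_set m \<psi> V) = 0"
    proof (rule hausdorff_measure_residual_set_eq_0[OF \<open>0 < s\<close> notI])
      assume "(\<Sum>\<^sub>\<infinity>I\<in>lists {1..m}. ennreal (\<rho> I powr s)) = \<infinity>"
      then have "ennreal s \<le> ?sup" using s by (intro SUP_upper) auto
      with x s show False by (simp add: not_less)
    qed
    then have "?dim \<le> ennreal s"
      unfolding hausdorff_dim_def using s by (intro INF_lower) auto
    with x s show False by (simp add: not_less)
  qed
  show "?sup \<le> ?dim"
    unfolding hausdorff_dim_def
  proof (intro SUP_least INF_greatest)
    fix t s assume "t \<in> {s. 0 \<le> s \<and> (\<Sum>\<^sub>\<infinity>I\<in>lists {1..m}. ennreal (\<rho> I powr s)) = \<infinity>}"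
      and "s \<in> {s. 0 \<le> s \<and> hausdorff_measure s (residual_set m \<psi> V) = 0}"
    then have t: "0 \<le> t" "(\<Sum>\<^sub>\<infinity>I\<in>lists {1..m}. ennreal (\<rho> I powr t)) = \<infinity>"
      and s: "0 \<le> s" "hausdorff_measure s (residual_set m \<psi> V) = 0" by auto
    show "ennreal t \<le> ennreal s"
    proof (rule ccontr)
      assume "\<not> ?thesis"
      then have "s < t" using ennreal_leI[of t s] by linarith
      then have "m \<noteq> 1" using infsum_single_map_finite[of t] s(1) t(2) by auto
      then show False
        using hausdorff_measure_residual_set_neq_0[OF s(1) \<open>s < t\<close> R t(2)] s(2) \<open>m \<ge> 1\<close> by simp
    qed
  qed
qed

end

section \<open>Distances and areas on the projective line\<close>

lemma inner_2: "x \<bullet> y = x$1 * y$1 + x$2 * y$2" for x y :: "real^2"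
  by (simp add: inner_vec_def sum_2)

text \<open>Lagrange's identity. It makes \<open>\<bar>area x y\<bar>\<close> over the product of
  the norms the sine of the angle between two lines, whose cosine defines their distance.\<close>

lemma inner_area_norm: "(x \<bullet> y)\<^sup>2 + (area x y)\<^sup>2 = (norm x)\<^sup>2 * (norm y)\<^sup>2"
  unfolding area_def power2_norm_eq_inner inner_2 by algebra

lemma abs_area_le: "\<bar>area x y\<bar> \<le> norm x * norm y"
proof -
  have "(area x y)\<^sup>2 \<le> (norm x * norm y)\<^sup>2"
    unfolding power_mult_distrib using inner_area_norm[of x y] zero_le_power2[of "x \<bullet> y"] by linarith
  then have "\<bar>area x y\<bar> \<le> \<bar>norm x * norm y\<bar>" by (simp only: abs_le_square_iff)
  then show ?thesis by simp
qed

text \<open>Cramer's rule without division; for independent \<open>x\<close> and \<open>y\<close> it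
  expresses \<open>z\<close> in that basis.\<close>

lemma area_expand: "area x y *\<^sub>R z = area z y *\<^sub>R x + area x z *\<^sub>R y"
  by (simp add: vec_eq_iff forall_2 area_def algebra_simps)

text \<open>By the half-angle formula, \<open>tan (t / 2) = sin t / (cos t + 1)\<close>, which is at
  most \<open>sin t\<close> on this range, while the tangent dominates its argument.\<close>

lemma le_two_sin:
  fixes t :: real
  assumes "0 \<le> t" "t \<le> pi / 2"
  shows "t \<le> 2 * sin t"
proof -
  have c: "0 \<le> cos t" and s: "0 \<le> sin t"
    using assms by (auto intro: cos_ge_zero sin_ge_zero)
  have p: "- (pi / 2) < t / 2" "t / 2 < pi / 2"
    using assms pi_gt_zero by linarith+
  have "tan (t / 2) = sin t / (cos t + 1)" by (simp add: tan_half)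
  also have "\<dots> \<le> sin t"
    using c s by (simp add: divide_le_eq mult_le_cancel_left1 distrib_left)
  finally have tn: "tan (t / 2) \<le> sin t" .
  have "0 \<le> tan (t / 2)" using \<open>tan (t / 2) = _\<close> c s by simp
  then have "arctan (tan (t / 2)) \<le> tan (t / 2)" by (rule arctan_le_self)
  then have "t / 2 \<le> tan (t / 2)" using arctan_tan[OF p] by simp
  with tn show ?thesis by simp
qed

text \<open>The distance is an angle \<open>t\<close> between 0 and \<open>pi / 2\<close> whose sine
  is this quotient, and there \<open>sin t \<le> t \<le> 2 * sin t\<close>. Estimates in the round
  metric thereby reduce to areas, which the maps preserve up to sign.\<close>

lemma
  assumes "x \<noteq> 0" "y \<noteq> 0"
  shows dist_proj_ge: "\<bar>area x y\<bar> / (norm x * norm y) \<le> dist (proj x) (proj y)"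
    and dist_proj_le: "dist (proj x) (proj y) \<le> 2 * (\<bar>area x y\<bar> / (norm x * norm y))"
proof -
  define u where "u = \<bar>x \<bullet> y\<bar> / (norm x * norm y)"
  define t where "t = arccos u"
  have n: "0 < norm x * norm y" using assms by simp
  have u: "0 \<le> u" "u \<le> 1"
    using n Cauchy_Schwarz_ineq2[of x y] by (auto simp: u_def divide_le_eq)
  have t: "0 \<le> t" "t \<le> pi / 2"
    unfolding t_def using u by (auto intro: arccos_lbound arccos_le_pi2[simplified])
  have "(sin t)\<^sup>2 = 1 - u\<^sup>2"
    using u sin_cos_squared_add[of t] by (simp add: t_def cos_arccos)
  also have "\<dots> = (\<bar>area x y\<bar> / (norm x * norm y))\<^sup>2"
  proof -
    have "u\<^sup>2 + (\<bar>area x y\<bar> / (norm x * norm y))\<^sup>2 = ((x \<bullet> y)\<^sup>2 + (area x y)\<^sup>2) / (norm x * norm y)\<^sup>2"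
      by (simp add: u_def power_divide add_divide_distrib)
    also have "\<dots> = 1" unfolding inner_area_norm power_mult_distrib using assms by simp
    finally show ?thesis by simp
  qed
  finally have "sin t = \<bar>area x y\<bar> / (norm x * norm y)"
  proof (rule power2_eq_imp_eq)
    show "0 \<le> sin t" using t pi_gt_zero by (intro sin_ge_zero) linarith+
  qed simp
  moreover have "dist (proj x) (proj y) = t"
    using assms by (simp add: dist_proj t_def u_def)
  ultimately show "\<bar>area x y\<bar> / (norm x * norm y) \<le> dist (proj x) (proj y)"
      "dist (proj x) (proj y) \<le> 2 * (\<bar>area x y\<bar> / (norm x * norm y))"
    using sin_x_le_x[OF t(1)] le_two_sin[OF t] by (simp_all only:)
qed

lemma proj_scaleR: "c \<noteq> 0 \<Longrightarrow> proj (c *\<^sub>R x) = proj x"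
proof (cases "x = 0")
  case False
  then show "c \<noteq> 0 \<Longrightarrow> proj (c *\<^sub>R x) = proj x"
    using proj_eq_iff[of x "c *\<^sub>R x"] by auto
qed simp

text \<open>The unit circle maps onto the projective line, and the area estimate makes this map
  Lipschitz, because \<open>area x y\<close> does not change when \<open>x\<close> is subtracted
  from \<open>y\<close>.\<close>

lemma compact_UNIV_rp1: "compact (UNIV :: rp1 set)"
proof -
  have "2-lipschitz_on (sphere 0 1) proj"
  proof (rule lipschitz_onI)
    fix x y :: "real^2" assume xy: "x \<in> sphere 0 1" "y \<in> sphere 0 1"
    then have "dist (proj x) (proj y) \<le> 2 * \<bar>area x y\<bar>"
      using dist_proj_le[of x y] by force
    also have "area x y = area x (y - x)" by (simp add: area_def algebra_simps)
    also have "2 * \<bar>area x (y - x)\<bar> \<le> 2 * (norm x * norm (y - x))"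
      using abs_area_le[of x "y - x"] by simp
    finally show "dist (proj x) (proj y) \<le> 2 * dist x y"
      using xy by (simp add: dist_norm norm_minus_commute)
  qed simp
  then have "compact (proj ` sphere 0 1)"
    by (intro compact_continuous_image lipschitz_on_continuous_on compact_sphere)
  moreover have "proj ` sphere 0 1 = UNIV"
  proof -
    have "p \<in> proj ` sphere 0 1" for p
    proof
      have r: "rep_rp1 p \<noteq> 0" by (rule rep_rp1_nonzero)
      then show "p = proj ((1 / norm (rep_rp1 p)) *\<^sub>R rep_rp1 p)"
        by (subst proj_scaleR) (auto simp: proj_rep_rp1)
      show "(1 / norm (rep_rp1 p)) *\<^sub>R rep_rp1 p \<in> sphere 0 1" using r by simp
    qed
    then show ?thesis by blast
  qed
  ultimately show ?thesis by simp
qed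

section \<open>Matrices in a basis\<close>

lemma max_norm_ge: "\<bar>M$i$j\<bar> \<le> max_norm M"
proof -
  have "{\<bar>M$i$j\<bar> | i j. True} = (\<lambda>(i, j). \<bar>M$i$j\<bar>) ` UNIV" by auto
  then have "finite {\<bar>M$i$j\<bar> | i j. True}" by simp
  then show ?thesis unfolding max_norm_def by (intro Max_ge) auto
qed

lemma max_norm_le: "(\<And>i j. \<bar>M$i$j\<bar> \<le> d) \<Longrightarrow> max_norm M \<le> d"
proof -
  assume *: "\<And>i j. \<bar>M$i$j\<bar> \<le> d"
  have "{\<bar>M$i$j\<bar> | i j. True} = (\<lambda>(i, j). \<bar>M$i$j\<bar>) ` UNIV" by auto
  then have "finite {\<bar>M$i$j\<bar> | i j. True}" by simp
  with * show ?thesis unfolding max_norm_def by (subst Max_le_iff) auto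
qed

text \<open>Otherwise both basis vectors would lie on the line through \<open>b 1\<close>, which
  misses one of the standard unit vectors.\<close>

lemma area_basis_neq_0:
  assumes "is_basis b"
  shows "area (b 1) (b 2) \<noteq> 0"
proof
  assume 0: "area (b 1) (b 2) = 0"
  have rb: "range b = {b 1, b 2}" by (auto simp: UNIV_2)
  have b1: "b 1 \<noteq> 0"
    using assms dependent_zero[of "range b"] unfolding is_basis_def by (metis rangeI)
  have "subspace {x. area x (b 1) = 0}"
    by (auto simp: subspace_def area_def algebra_simps)
  moreover have "range b \<subseteq> {x. area x (b 1) = 0}"
    unfolding rb using 0 by (auto simp: area_def algebra_simps)
  ultimately have "span (range b) \<subseteq> {x. area x (b 1) = 0}" by (rule span_minimal[rotated])
  then have all: "area x (b 1) = 0" for x using assms unfolding is_basis_def by auto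
  have "area (vector [1, 0]) (b 1) = b 1 $ 2" "area (vector [0, 1]) (b 1) = - (b 1 $ 1)"
    by (simp_all add: area_def)
  with all b1 show False by (auto simp: vec_eq_iff forall_2)
qed

lemma represents_id: "represents b id (mat 1)"
proof -
  have "(\<Sum>i\<in>UNIV. (if i = j then 1 else 0) *\<^sub>R b i) = b j" for j
  proof -
    have "(\<Sum>i\<in>UNIV. (if i = j then 1 else 0) *\<^sub>R b i) = (\<Sum>i\<in>UNIV. if i = j then b i else 0)"
      by (intro sum.cong) auto
    then show ?thesis by simp
  qed
  then show ?thesis by (simp add: represents_def mat_def)
qed

lemma represents_comp:
  assumes "linear F" "represents b F M" "represents b G M'"
  shows "represents b (F \<circ> G) (M ** M')"
  unfolding represents_def
proof
  fix j
  have "(F \<circ> G) (b j) = (\<Sum>k\<in>UNIV. M'$k$j *\<^sub>R (\<Sum>i\<in>UNIV. M$i$k *\<^sub>R b i))"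
    using assms by (simp add: represents_def linear_sum linear_scale)
  also have "\<dots> = (\<Sum>k\<in>UNIV. \<Sum>i\<in>UNIV. (M$i$k * M'$k$j) *\<^sub>R b i)"
    by (simp add: scaleR_sum_right mult.commute)
  also have "\<dots> = (\<Sum>i\<in>UNIV. \<Sum>k\<in>UNIV. (M$i$k * M'$k$j) *\<^sub>R b i)"
    by (rule sum.swap)
  also have "\<dots> = (\<Sum>i\<in>UNIV. (M ** M')$i$j *\<^sub>R b i)"
    by (simp add: matrix_matrix_mult_def scaleR_sum_left)
  finally show "(F \<circ> G) (b j) = (\<Sum>i\<in>UNIV. (M ** M')$i$j *\<^sub>R b i)" .
qed

lemma norm_linear_le_of_area:
  assumes "linear F" "area x y \<noteq> 0"
  shows "norm (F z) \<le> (norm z * norm y * norm (F x) + norm x * norm z * norm (F y)) / \<bar>area x y\<bar>"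
proof -
  have "area x y *\<^sub>R F z = F (area x y *\<^sub>R z)" using assms by (simp add: linear_scale)
  also have "\<dots> = area z y *\<^sub>R F x + area x z *\<^sub>R F y"
    unfolding area_expand[of x y z] using assms(1) by (simp add: linear_add linear_scale)
  finally have "\<bar>area x y\<bar> * norm (F z) = norm (area z y *\<^sub>R F x + area x z *\<^sub>R F y)"
    by (metis norm_scaleR)
  also have "\<dots> \<le> \<bar>area z y\<bar> * norm (F x) + \<bar>area x z\<bar> * norm (F y)"
    by (metis norm_scaleR norm_triangle_ineq)
  also have "\<dots> \<le> (norm z * norm y) * norm (F x) + (norm x * norm z) * norm (F y)"
    by (intro add_mono mult_right_mono abs_area_le) auto
  finally show ?thesis using assms(2) by (simp add: field_simps)
qed

lemma norm_le_max_norm: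
  assumes "is_basis b"
  shows "\<exists>k>0. \<forall>F M x. linear F \<longrightarrow> represents b F M \<longrightarrow> norm (F x) \<le> k * max_norm M * norm x"
proof -
  define s where "s = norm (b 1) + norm (b 2)"
  have nz: "area (b 1) (b 2) \<noteq> 0" using area_basis_neq_0[OF assms] .
  have s: "0 \<le> s" "norm (b 1) \<le> s" "norm (b 2) \<le> s" by (auto simp: s_def)
  define k where "k = 2 * (s * s) / \<bar>area (b 1) (b 2)\<bar> + 1"
  have "0 \<le> 2 * (s * s) / \<bar>area (b 1) (b 2)\<bar>" using s by auto
  then have "k > 0" unfolding k_def by linarith
  moreover have "norm (F x) \<le> k * max_norm M * norm x" if F: "linear F" "represents b F M" for F M x
  proof -
    have N0: "0 \<le> max_norm M" using max_norm_ge[of M 1 1] by linarith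
    have Fb: "norm (F (b j)) \<le> max_norm M * s" for j
    proof -
      have "F (b j) = M$1$j *\<^sub>R b 1 + M$2$j *\<^sub>R b 2" using F by (simp add: represents_def sum_2)
      then have "norm (F (b j)) \<le> \<bar>M$1$j\<bar> * norm (b 1) + \<bar>M$2$j\<bar> * norm (b 2)"
        by (metis norm_scaleR norm_triangle_ineq)
      also have "\<dots> \<le> max_norm M * norm (b 1) + max_norm M * norm (b 2)"
        by (intro add_mono mult_right_mono max_norm_ge) auto
      finally show ?thesis by (simp add: s_def distrib_left)
    qed
    have "norm (F x) \<le> (norm x * norm (b 2) * norm (F (b 1)) + norm (b 1) * norm x * norm (F (b 2)))
        / \<bar>area (b 1) (b 2)\<bar>"
      by (rule norm_linear_le_of_area[OF F(1) nz])
    also have "\<dots> \<le> (norm x * s * (max_norm M * s) + s * norm x * (max_norm M * s)) / \<bar>area (b 1) (b 2)\<bar>"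
      using s Fb N0 by (intro divide_right_mono add_mono mult_mono) auto
    also have "\<dots> = (2 * (s * s) / \<bar>area (b 1) (b 2)\<bar>) * (max_norm M * norm x)"
      by (simp add: algebra_simps)
    also have "\<dots> \<le> k * (max_norm M * norm x)"
      using N0 by (intro mult_right_mono) (auto simp: k_def)
    finally show ?thesis by (simp add: mult.assoc)
  qed
  ultimately show ?thesis by blast
qed

text \<open>A matrix entry is an area of \<open>F (b j)\<close> against a basis vector, up to sign,
  divided by the area of the basis; \<open>F (b j)\<close> is in turn controlled by the two values
  of \<open>F\<close>. The constant precedes the quantifier over \<open>F\<close> because it has to
  serve all words at once.\<close>

lemma max_norm_le_norm:
  assumes "is_basis b" "area x y \<noteq> 0"
  shows "\<exists>k>0. \<forall>F M. linear F \<longrightarrow> represents b F M \<longrightarrow> max_norm M \<le> k * (norm (F x) + norm (F y))"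
proof -
  define s where "s = norm (b 1) + norm (b 2)"
  define r where "r = norm x + norm y"
  have nz: "area (b 1) (b 2) \<noteq> 0" using area_basis_neq_0[OF assms(1)] .
  have s: "0 \<le> s" "norm (b 1) \<le> s" "norm (b 2) \<le> s" by (auto simp: s_def)
  have r: "0 \<le> r" "norm x \<le> r" "norm y \<le> r" by (auto simp: r_def)
  define k where "k = s * r / \<bar>area x y\<bar> * s / \<bar>area (b 1) (b 2)\<bar> + 1"
  have "0 \<le> s * r / \<bar>area x y\<bar> * s / \<bar>area (b 1) (b 2)\<bar>" using s r by auto
  then have "k > 0" unfolding k_def by linarith
  moreover have "max_norm M \<le> k * (norm (F x) + norm (F y))" if F: "linear F" "represents b F M" for F M
  proof (rule max_norm_le)
    fix i j
    have bj: "norm (b j) \<le> s" using exhaust_2[of j] s by auto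
    have Fb: "norm (F (b j)) \<le> s * r / \<bar>area x y\<bar> * (norm (F x) + norm (F y))"
    proof -
      have "norm (F (b j)) \<le> (norm (b j) * norm y * norm (F x) + norm x * norm (b j) * norm (F y)) / \<bar>area x y\<bar>"
        by (rule norm_linear_le_of_area[OF F(1) assms(2)])
      also have "\<dots> \<le> (s * r * norm (F x) + r * s * norm (F y)) / \<bar>area x y\<bar>"
        using s r bj by (intro divide_right_mono add_mono mult_mono) auto
      also have "\<dots> = s * r / \<bar>area x y\<bar> * (norm (F x) + norm (F y))"
        by (simp add: algebra_simps add_divide_distrib)
      finally show ?thesis .
    qed
    have "F (b j) = M$1$j *\<^sub>R b 1 + M$2$j *\<^sub>R b 2" using F by (simp add: represents_def sum_2)
    then have "area (F (b j)) (b 2) = M$1$j * area (b 1) (b 2)"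
      "area (b 1) (F (b j)) = M$2$j * area (b 1) (b 2)"
      by (simp_all add: area_def algebra_simps)
    moreover have "\<bar>area (F (b j)) (b 2)\<bar> \<le> norm (F (b j)) * s"
      by (rule order_trans[OF abs_area_le]) (intro mult_left_mono s, simp)
    moreover have "\<bar>area (b 1) (F (b j))\<bar> \<le> norm (F (b j)) * s"
      by (rule order_trans[OF abs_area_le]) (subst mult.commute, intro mult_left_mono s, simp)
    ultimately have "\<bar>M$i$j\<bar> * \<bar>area (b 1) (b 2)\<bar> \<le> norm (F (b j)) * s"
      using exhaust_2[of i] by (auto simp: abs_mult)
    also have "\<dots> \<le> s * r / \<bar>area x y\<bar> * (norm (F x) + norm (F y)) * s"
      by (intro mult_right_mono Fb s)
    also have "\<dots> = (s * r / \<bar>area x y\<bar> * s / \<bar>area (b 1) (b 2)\<bar>) * (norm (F x) + norm (F y)) * \<bar>area (b 1) (b 2)\<bar>"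
      using nz by simp
    finally have "\<bar>M$i$j\<bar> \<le> (s * r / \<bar>area x y\<bar> * s / \<bar>area (b 1) (b 2)\<bar>) * (norm (F x) + norm (F y))"
      by (rule mult_right_le_imp_le) (use nz in simp)
    also have "\<dots> \<le> k * (norm (F x) + norm (F y))"
      by (intro mult_right_mono) (auto simp: k_def)
    finally show "\<bar>M$i$j\<bar> \<le> k * (norm (F x) + norm (F y))" .
  qed
  ultimately show ?thesis by blast
qed

section \<open>Projective systems in an affine chart\<close>

text \<open>The solution of \<open>\<alpha> \<bullet> x = t\<close>,
  \<open>\<beta> \<bullet> x = 1\<close> by Cramer's rule: the representative, on the affine line
  where the form \<beta> takes the value 1, of the projective point with coordinate
  \<open>t\<close>.\<close>

definition chart_vec :: "real^2 \<Rightarrow> real^2 \<Rightarrow> real \<Rightarrow> real^2" where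
  "chart_vec \<alpha> \<beta> t = vector [(t * \<beta>$2 - \<alpha>$2) / area \<alpha> \<beta>, (\<alpha>$1 - t * \<beta>$1) / area \<alpha> \<beta>]"

lemma
  assumes "area \<alpha> \<beta> \<noteq> 0"
  shows inner_chart_vec: "\<alpha> \<bullet> chart_vec \<alpha> \<beta> t = t" "\<beta> \<bullet> chart_vec \<alpha> \<beta> t = 1"
    and area_chart_vec: "area (chart_vec \<alpha> \<beta> t) (chart_vec \<alpha> \<beta> s) = (t - s) / area \<alpha> \<beta>"
    and chart_vec_eqI: "\<alpha> \<bullet> x = t * (\<beta> \<bullet> x) \<Longrightarrow> x = (\<beta> \<bullet> x) *\<^sub>R chart_vec \<alpha> \<beta> t"
proof -
  let ?d = "area \<alpha> \<beta>"
  have d: "?d = \<alpha>$1 * \<beta>$2 - \<alpha>$2 * \<beta>$1" by (simp add: area_def)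
  have "\<alpha> \<bullet> chart_vec \<alpha> \<beta> t = t * (\<alpha>$1 * \<beta>$2 - \<alpha>$2 * \<beta>$1) / ?d"
    by (simp add: inner_2 chart_vec_def add_divide_distrib[symmetric] algebra_simps)
  then show 1: "\<alpha> \<bullet> chart_vec \<alpha> \<beta> t = t" using assms by (simp flip: d)
  have "\<beta> \<bullet> chart_vec \<alpha> \<beta> t = (\<alpha>$1 * \<beta>$2 - \<alpha>$2 * \<beta>$1) / ?d"
    by (simp add: inner_2 chart_vec_def add_divide_distrib[symmetric] algebra_simps)
  then show 2: "\<beta> \<bullet> chart_vec \<alpha> \<beta> t = 1" using assms by (simp flip: d)
  have "area (chart_vec \<alpha> \<beta> t) (chart_vec \<alpha> \<beta> s)
      = ((t * \<beta>$2 - \<alpha>$2) * (\<alpha>$1 - s * \<beta>$1) - (\<alpha>$1 - t * \<beta>$1) * (s * \<beta>$2 - \<alpha>$2)) / (?d * ?d)"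
    unfolding area_def[of "chart_vec \<alpha> \<beta> t"]
    by (simp only: chart_vec_def vector_2 times_divide_times_eq diff_divide_distrib[symmetric])
  also have "(t * \<beta>$2 - \<alpha>$2) * (\<alpha>$1 - s * \<beta>$1) - (\<alpha>$1 - t * \<beta>$1) * (s * \<beta>$2 - \<alpha>$2) = (t - s) * ?d"
    unfolding d by algebra
  finally show "area (chart_vec \<alpha> \<beta> t) (chart_vec \<alpha> \<beta> s) = (t - s) / ?d"
    using assms by simp
  assume x: "\<alpha> \<bullet> x = t * (\<beta> \<bullet> x)"
  have "x$1 * ?d = (\<beta> \<bullet> x) * (t * \<beta>$2 - \<alpha>$2)" "x$2 * ?d = (\<beta> \<bullet> x) * (\<alpha>$1 - t * \<beta>$1)"
    using x unfolding d inner_2 by algebra+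
  then show "x = (\<beta> \<bullet> x) *\<^sub>R chart_vec \<alpha> \<beta> t"
    using assms by (simp add: vec_eq_iff forall_2 chart_vec_def field_simps)
qed

text \<open>The chart is given by its two linear forms, the contraction hypothesis is freed from the
  inverse of the chart, and one constant \<open>L\<close> serves all maps.\<close>

locale projective_ifs =
  fixes m :: nat and f :: "nat \<Rightarrow> real^2 \<Rightarrow> real^2" and \<psi> :: "nat \<Rightarrow> rp1 \<Rightarrow> rp1"
    and V :: "rp1 set" and \<alpha> \<beta> :: "real^2" and \<phi> :: "rp1 \<Rightarrow> real" and L :: real
    and b :: "2 \<Rightarrow> real^2" and A :: "nat \<Rightarrow> real^2^2"
  assumes f: "i \<in> {1..m} \<Longrightarrow> linear (f i) \<and> bij (f i) \<and> preserves_area_up_to_sign (f i)"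
    and \<psi>: "i \<in> {1..m} \<Longrightarrow> \<psi> i = proj_map (f i)"
    and basis: "is_basis b"
    and A: "i \<in> {1..m} \<Longrightarrow> represents b (f i) (A i)"
    and open_V: "open V" and V_ne: "V \<noteq> {}"
    and osc: "open_set_condition m \<psi> V"
    and area_nz: "area \<alpha> \<beta> \<noteq> 0"
    and \<phi>: "\<beta> \<bullet> x \<noteq> 0 \<Longrightarrow> \<phi> (proj x) = (\<alpha> \<bullet> x) / (\<beta> \<bullet> x)"
    and closure_V: "closure V \<subseteq> proj ` {x. \<beta> \<bullet> x \<noteq> 0}"
    and L: "0 < L" "L < 1"
    and contr: "i \<in> {1..m} \<Longrightarrow> p \<in> V \<Longrightarrow> q \<in> V \<Longrightarrow> \<bar>\<phi> (\<psi> i p) - \<phi> (\<psi> i q)\<bar> \<le> L * \<bar>\<phi> p - \<phi> q\<bar>"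
begin

abbreviation v :: "real \<Rightarrow> real^2" where "v \<equiv> chart_vec \<alpha> \<beta>"

text \<open>The derivative of \<^term>\<open>word_map \<psi> I\<close> in the chart is \<open>\<plusminus> 1 / (denom I t)\<^sup>2\<close>.\<close>

definition denom :: "nat list \<Rightarrow> real \<Rightarrow> real" where
  "denom I t = \<beta> \<bullet> word_map f I (v t)"

definition chart_map :: "nat list \<Rightarrow> real \<Rightarrow> real" where
  "chart_map I t = \<phi> (word_map \<psi> I (proj (v t)))"

lemma v_neq_0: "v t \<noteq> 0"
  using inner_chart_vec(2)[OF area_nz, of t] by auto

lemma \<beta>_neq_0: "\<beta> \<noteq> 0"
  using area_nz by (auto simp: area_def)

lemma \<phi>_v [simp]: "\<phi> (proj (v t)) = t"
  using \<phi>[of "v t"] by (simp add: inner_chart_vec[OF area_nz])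

lemma proj_v_\<phi>: "\<beta> \<bullet> x \<noteq> 0 \<Longrightarrow> x = (\<beta> \<bullet> x) *\<^sub>R v (\<phi> (proj x))"
  by (rule chart_vec_eqI[OF area_nz]) (simp add: \<phi>)

lemma V_coord:
  assumes "p \<in> V" shows "p = proj (v (\<phi> p))" "\<phi> p \<in> \<phi> ` V"
proof -
  obtain x where x: "\<beta> \<bullet> x \<noteq> 0" "p = proj x"
    using assms closure_V closure_subset[of V] by blast
  then show "p = proj (v (\<phi> p))"
    using proj_v_\<phi>[of x] by (metis proj_scaleR)
qed (use assms in blast)

lemma coord_V: "t \<in> \<phi> ` V \<Longrightarrow> proj (v t) \<in> V"
  using V_coord(1) by auto

section \<open>Words as linear maps and as maps of the chart\<close>

lemma word_map_f:
  assumes "I \<in> lists {1..m}"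
  shows "linear (word_map f I)" "preserves_area_up_to_sign (word_map f I)"
proof -
  have "linear (word_map f I) \<and> preserves_area_up_to_sign (word_map f I)"
    using assms
  proof (induction I)
    case Nil
    then show ?case by (auto simp: preserves_area_up_to_sign_def id_def linear_ident)
  next
    case (Cons i I)
    then have "i \<in> {1..m}" "preserves_area_up_to_sign (word_map f I)" by auto
    with f[of i] obtain e e' where "e \<in> {1, -1}" "\<And>u v. area (f i u) (f i v) = e * area u v"
      "e' \<in> {1, -1}" "\<And>u v. area (word_map f I u) (word_map f I v) = e' * area u v"
      unfolding preserves_area_up_to_sign_def by meson
    then have "preserves_area_up_to_sign (word_map f (i # I))"
      unfolding preserves_area_up_to_sign_def by (intro bexI[of _ "e * e'"]) auto
    moreover have "linear (word_map f (i # I))"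
      using Cons f[of i] unfolding word_map_simps by (intro linear_compose) auto
    ultimately show ?case by (intro conjI)
  qed
  then show "linear (word_map f I)" "preserves_area_up_to_sign (word_map f I)" by auto
qed

lemma abs_area_word_map:
  "I \<in> lists {1..m} \<Longrightarrow> \<bar>area (word_map f I x) (word_map f I y)\<bar> = \<bar>area x y\<bar>"
  using word_map_f(2)[of I] by (auto simp: preserves_area_up_to_sign_def abs_mult)

lemma word_map_f_neq_0:
  assumes "I \<in> lists {1..m}" "x \<noteq> 0" shows "word_map f I x \<noteq> 0"
proof
  assume 0: "word_map f I x = 0"
  \<comment> \<open>The second argument is \<open>x\<close> turned by a right angle; its area with
    \<open>x\<close> is the squared norm, and areas survive the map up to sign.\<close>
  have "area x (vector [- x$2, x$1]) = x \<bullet> x" by (simp add: area_def inner_2)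
  then show False
    using abs_area_word_map[OF assms(1), of x "vector [- x$2, x$1]"] 0 assms(2)
    by (simp add: area_def)
qed

lemma word_map_proj:
  "I \<in> lists {1..m} \<Longrightarrow> x \<noteq> 0 \<Longrightarrow> word_map \<psi> I (proj x) = proj (word_map f I x)"
proof (induction I)
  case (Cons i I)
  then show ?case
    using f[of i] \<psi>[of i] word_map_f_neq_0[of I x] by (auto simp: proj_map_proj)
qed simp

lemma represents_word: "I \<in> lists {1..m} \<Longrightarrow> represents b (word_map f I) (word_matrix A I)"
proof (induction I)
  case Nil
  then show ?case using represents_id[of b] by (simp add: word_matrix_def id_def)
next
  case (Cons i I)
  then show ?case
    using represents_comp[of "f i" b "A i"] f[of i] A[of i] by (simp add: word_matrix_def comp_def)
qed

lemma chart_map_in: "I \<in> lists {1..m} \<Longrightarrow> t \<in> \<phi> ` V \<Longrightarrow> chart_map I t \<in> \<phi> ` V"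
  unfolding chart_map_def using word_map_mem[OF osc] coord_V by blast

text \<open>A point of \<open>V\<close> is mapped into \<open>V\<close>, hence into the domain of
  the chart, where \<beta> does not vanish; dividing the image vector by its value under \<beta>
  produces a chart vector.\<close>

lemma
  assumes I: "I \<in> lists {1..m}" and t: "t \<in> \<phi> ` V"
  shows denom_neq_0: "denom I t \<noteq> 0"
    and word_map_f_v: "word_map f I (v t) = denom I t *\<^sub>R v (chart_map I t)"
    and word_map_v: "word_map \<psi> I (proj (v t)) = proj (v (chart_map I t))"
proof -
  have V: "proj (word_map f I (v t)) \<in> V"
    using word_map_mem[OF osc I coord_V[OF t]] word_map_proj[OF I v_neq_0] by simp
  then obtain x where x: "\<beta> \<bullet> x \<noteq> 0" "proj (word_map f I (v t)) = proj x"
    using closure_V closure_subset[of V] by blast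
  moreover have "x \<noteq> 0" using x by auto
  ultimately obtain c where "c \<noteq> 0" "x = c *\<^sub>R word_map f I (v t)"
    using proj_eq_iff[OF word_map_f_neq_0[OF I v_neq_0]] by metis
  with x show nz: "denom I t \<noteq> 0" by (auto simp: denom_def)
  show "word_map f I (v t) = denom I t *\<^sub>R v (chart_map I t)"
    using proj_v_\<phi>[of "word_map f I (v t)"] nz
    by (simp add: denom_def chart_map_def word_map_proj[OF I v_neq_0])
  show "word_map \<psi> I (proj (v t)) = proj (v (chart_map I t))"
    using V_coord(1)[OF V] word_map_proj[OF I v_neq_0] by (simp add: chart_map_def)
qed

text \<open>Two chart vectors and their images span the same area up to sign, and the area of two
  chart vectors is proportional to the difference of their coordinates. The identity takes the place
  of a derivative at pairs of points that no segment in the domain needs to join.\<close>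

lemma chart_map_diff:
  assumes I: "I \<in> lists {1..m}" and t: "t \<in> \<phi> ` V" "s \<in> \<phi> ` V"
  shows "\<bar>chart_map I t - chart_map I s\<bar> * (\<bar>denom I t\<bar> * \<bar>denom I s\<bar>) = \<bar>t - s\<bar>"
proof -
  have sc: "area (c *\<^sub>R x) (d *\<^sub>R y) = c * d * area x y" for c d x y
    by (simp add: area_def algebra_simps)
  have "\<bar>area (word_map f I (v t)) (word_map f I (v s))\<bar> = \<bar>area (v t) (v s)\<bar>"
    by (rule abs_area_word_map[OF I])
  then show ?thesis
    unfolding word_map_f_v[OF I t(1)] word_map_f_v[OF I t(2)] sc area_chart_vec[OF area_nz]
    using area_nz by (simp add: abs_mult mult_ac)
qed

text \<open>The chain rule in the chart: denominators form a multiplicative cocycle, each letter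
  being evaluated at the point reached so far.\<close>

lemma
  assumes "i \<in> {1..m}" "I \<in> lists {1..m}" "t \<in> \<phi> ` V"
  shows chart_map_Cons: "chart_map (i # I) t = chart_map [i] (chart_map I t)"
    and denom_Cons: "denom (i # I) t = denom I t * denom [i] (chart_map I t)"
proof -
  show "chart_map (i # I) t = chart_map [i] (chart_map I t)"
    using word_map_v[OF assms(2,3)] by (simp add: chart_map_def)
  show "denom (i # I) t = denom I t * denom [i] (chart_map I t)"
  proof -
    have "f i (word_map f I (v t)) = denom I t *\<^sub>R f i (v (chart_map I t))"
      using f[OF assms(1)] by (subst word_map_f_v[OF assms(2,3)]) (simp add: linear_scale)
    then show ?thesis by (simp add: denom_def[of "i # I"] denom_def[of "[i]"])
  qed
qed

lemma chart_map_contraction: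
  assumes "I \<in> lists {1..m}" "t \<in> \<phi> ` V" "s \<in> \<phi> ` V"
  shows "\<bar>chart_map I t - chart_map I s\<bar> \<le> L ^ length I * \<bar>t - s\<bar>"
  using assms(1)
proof (induction I)
  case Nil
  then show ?case by (simp add: chart_map_def)
next
  case (Cons i I)
  then have I: "i \<in> {1..m}" "I \<in> lists {1..m}" by auto
  have "\<bar>chart_map (i # I) t - chart_map (i # I) s\<bar>
      \<le> L * \<bar>chart_map I t - chart_map I s\<bar>"
    using contr[OF I(1) coord_V[OF chart_map_in[OF I(2) assms(2)]] coord_V[OF chart_map_in[OF I(2) assms(3)]]]
    unfolding chart_map_Cons[OF I assms(2)] chart_map_Cons[OF I assms(3)]
    by (simp add: chart_map_def[of "[i]"])
  also have "\<dots> \<le> L * (L ^ length I * \<bar>t - s\<bar>)"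
    using Cons L by (intro mult_left_mono) auto
  finally show ?case by simp
qed

section \<open>The chart compared with the round metric\<close>

lemma norm_v_ge: "1 / norm \<beta> \<le> norm (v t)"
proof -
  have "1 = \<beta> \<bullet> v t" by (simp add: inner_chart_vec[OF area_nz])
  also have "\<dots> \<le> norm \<beta> * norm (v t)" by (rule norm_cauchy_schwarz)
  finally show ?thesis using \<beta>_neq_0 by (simp add: divide_le_eq mult.commute)
qed

text \<open>The closure of \<open>V\<close> avoids the point at infinity of the chart, so
  \<open>V\<close> stays a fixed distance away from it, while that distance is at most a constant
  divided by \<open>norm (v t)\<close>.\<close>

lemma bounded_v: "\<exists>k>0. \<forall>t\<in>\<phi> ` V. norm (v t) \<le> k"
proof -
  \<comment> \<open>\<open>w\<close> is \<beta> turned by a right angle; it spans the kernel of the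
    form \<beta> and so represents the point at infinity.\<close>
  define w :: "real^2" where "w = vector [- \<beta>$2, \<beta>$1]"
  have w: "area x w = \<beta> \<bullet> x" "\<beta> \<bullet> w = 0" "norm w = norm \<beta>" for x
    by (simp_all add: w_def area_def inner_2 norm_vec_def L2_set_def sum_2 add.commute)
  have "w \<noteq> 0" using w(3) \<beta>_neq_0 by auto
  have "proj w \<notin> proj ` {x. \<beta> \<bullet> x \<noteq> 0}"
  proof
    assume "proj w \<in> proj ` {x. \<beta> \<bullet> x \<noteq> 0}"
    then obtain x where x: "\<beta> \<bullet> x \<noteq> 0" "proj w = proj x" by auto
    moreover have "x \<noteq> 0" using x by auto
    ultimately obtain c where "x = c *\<^sub>R w" using proj_eq_iff[OF \<open>w \<noteq> 0\<close>] by metis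
    with x w(2) show False by simp
  qed
  then have "proj w \<notin> closure V" using closure_V by blast
  then obtain e where e: "e > 0" "\<And>p. p \<in> V \<Longrightarrow> e \<le> dist p (proj w)"
    unfolding closure_approachable by force
  have "norm (v t) \<le> 2 / (e * norm \<beta>)" if "t \<in> \<phi> ` V" for t
  proof -
    have "e \<le> dist (proj (v t)) (proj w)" using e(2) coord_V[OF that] .
    also have "\<dots> \<le> 2 * (\<bar>area (v t) w\<bar> / (norm (v t) * norm w))"
      by (rule dist_proj_le[OF v_neq_0 \<open>w \<noteq> 0\<close>])
    also have "\<dots> = 2 / (norm (v t) * norm \<beta>)"
      by (simp add: w inner_chart_vec[OF area_nz])
    finally show ?thesis
      using e(1) v_neq_0[of t] \<beta>_neq_0 by (simp add: field_simps)
  qed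
  moreover have "2 / (e * norm \<beta>) > 0" using e \<beta>_neq_0 by simp
  ultimately show ?thesis by blast
qed

lemma dist_chart_le: "dist (proj (v t)) (proj (v s)) \<le> 2 * (norm \<beta>)\<^sup>2 / \<bar>area \<alpha> \<beta>\<bar> * \<bar>t - s\<bar>"
proof -
  have "1 * 1 \<le> (norm \<beta> * norm (v t)) * (norm \<beta> * norm (v s))"
    using norm_v_ge[of t] norm_v_ge[of s] \<beta>_neq_0
    by (intro mult_mono) (simp_all add: divide_le_eq mult.commute)
  then have "1 / (norm (v t) * norm (v s)) \<le> (norm \<beta>)\<^sup>2"
    using v_neq_0 by (simp add: divide_le_eq power2_eq_square mult_ac)
  then have "2 * (\<bar>t - s\<bar> / \<bar>area \<alpha> \<beta>\<bar>) * (1 / (norm (v t) * norm (v s)))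
      \<le> 2 * (\<bar>t - s\<bar> / \<bar>area \<alpha> \<beta>\<bar>) * (norm \<beta>)\<^sup>2"
    by (intro mult_left_mono) auto
  moreover have "dist (proj (v t)) (proj (v s)) \<le> 2 * (\<bar>t - s\<bar> / \<bar>area \<alpha> \<beta>\<bar>) * (1 / (norm (v t) * norm (v s)))"
    using dist_proj_le[OF v_neq_0 v_neq_0, of t s] by (simp add: area_chart_vec[OF area_nz])
  ultimately show ?thesis by (simp add: mult_ac)
qed

text \<open>Long chart vectors lie close to the point at infinity, where the chart stretches
  distances without bound; on \<open>V\<close> the bound \<open>k\<close> comes from
  \<open>bounded_v\<close>, so there the chart is bi-Lipschitz.\<close>

lemma dist_chart_ge:
  assumes "norm (v t) \<le> k" "norm (v s) \<le> k"
  shows "1 / (\<bar>area \<alpha> \<beta>\<bar> * k\<^sup>2) * \<bar>t - s\<bar> \<le> dist (proj (v t)) (proj (v s))"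
proof -
  have "0 \<le> k" using assms(1) norm_ge_zero order_trans by blast
  then have k: "norm (v t) * norm (v s) \<le> k\<^sup>2" "0 < norm (v t) * norm (v s)"
    using assms v_neq_0 unfolding power2_eq_square
    by (auto intro!: mult_mono)
  have "1 / (\<bar>area \<alpha> \<beta>\<bar> * k\<^sup>2) * \<bar>t - s\<bar> = (\<bar>t - s\<bar> / \<bar>area \<alpha> \<beta>\<bar>) / k\<^sup>2" by simp
  also have "\<dots> \<le> (\<bar>t - s\<bar> / \<bar>area \<alpha> \<beta>\<bar>) / (norm (v t) * norm (v s))"
  proof (rule divide_left_mono)
    have "0 < k\<^sup>2" using k by linarith
    then show "0 < k\<^sup>2 * (norm (v t) * norm (v s))" using k(2) by (rule mult_pos_pos)
  qed (use k in auto)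
  also have "\<dots> \<le> dist (proj (v t)) (proj (v s))"
    using dist_proj_ge[OF v_neq_0 v_neq_0, of t s] by (simp add: area_chart_vec[OF area_nz])
  finally show ?thesis .
qed

lemma chart_open:
  assumes "t \<in> \<phi> ` V" shows "\<exists>e>0. \<forall>s. \<bar>s - t\<bar> < e \<longrightarrow> s \<in> \<phi> ` V"
proof -
  define k where "k = 2 * (norm \<beta>)\<^sup>2 / \<bar>area \<alpha> \<beta>\<bar>"
  have k: "k > 0" using area_nz \<beta>_neq_0 by (simp add: k_def)
  obtain e where e: "e > 0" "\<And>q. dist q (proj (v t)) < e \<Longrightarrow> q \<in> V"
    using open_V coord_V[OF assms] unfolding open_dist by blast
  have "s \<in> \<phi> ` V" if "\<bar>s - t\<bar> < e / k" for s
  proof -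
    have "dist (proj (v s)) (proj (v t)) \<le> k * \<bar>s - t\<bar>"
      unfolding k_def by (rule dist_chart_le)
    also have "\<dots> < e" using that k by (simp add: field_simps)
    finally have "proj (v s) \<in> V" by (rule e(2))
    then show ?thesis by (rule rev_image_eqI) simp
  qed
  with e k show ?thesis by (intro exI[of _ "e / k"]) auto
qed

section \<open>Bounded distortion of the denominators\<close>

lemma denom_lipschitz:
  "\<exists>B\<ge>0. \<forall>i\<in>{1..m}. \<forall>s t. \<bar>denom [i] t - denom [i] s\<bar> \<le> B * \<bar>t - s\<bar>"
proof -
  \<comment> \<open>Chart vectors are affine in the coordinate with direction \<open>w\<close>, so
    \<open>denom [i]\<close> is affine with slope \<open>\<beta> \<bullet> f i w\<close>;
    \<open>B\<close> dominates all these slopes.\<close>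
  define w where "w = v 1 - v 0"
  define B where "B = (\<Sum>i\<in>{1..m}. \<bar>\<beta> \<bullet> f i w\<bar>)"
  have "\<bar>denom [i] t - denom [i] s\<bar> \<le> B * \<bar>t - s\<bar>" if i: "i \<in> {1..m}" for i s t
  proof -
    have "v t - v s = (t - s) *\<^sub>R w"
      by (simp add: vec_eq_iff forall_2 chart_vec_def w_def diff_divide_distrib algebra_simps)
    then have "denom [i] t - denom [i] s = (t - s) * (\<beta> \<bullet> f i w)"
      using f[OF i] by (simp add: denom_def flip: inner_diff_right linear_diff linear_scale inner_scaleR_right)
    moreover have "\<bar>\<beta> \<bullet> f i w\<bar> \<le> B"
      unfolding B_def using i by (intro member_le_sum[where f="\<lambda>i. \<bar>\<beta> \<bullet> f i w\<bar>"]) auto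
    ultimately show ?thesis by (simp add: abs_mult mult.commute[of B] mult_left_mono)
  qed
  moreover have "B \<ge> 0" by (auto simp: B_def intro: sum_nonneg)
  ultimately show ?thesis by blast
qed

text \<open>By the two-point formula, a denominator below 1 at \<open>t\<close>, and by continuity
  at a nearby point as well, would make the map expand between the two points, against the
  contraction. Openness of \<open>V\<close> supplies the nearby point.\<close>

lemma denom_ge_1:
  assumes i: "i \<in> {1..m}" and t: "t \<in> \<phi> ` V"
  shows "1 \<le> \<bar>denom [i] t\<bar>"
proof (rule ccontr)
  assume "\<not> ?thesis"
  then have lt: "\<bar>denom [i] t\<bar> < 1" by simp
  obtain B where B: "B \<ge> 0" "\<And>s. \<bar>denom [i] s - denom [i] t\<bar> \<le> B * \<bar>s - t\<bar>"
    using denom_lipschitz i by blast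
  obtain e where e: "e > 0" "\<And>s. \<bar>s - t\<bar> < e \<Longrightarrow> s \<in> \<phi> ` V" using chart_open[OF t] by blast
  \<comment> \<open>Small enough to stay in the chart image of \<open>V\<close> and to move the
    denominator by less than its gap to 1; the summand 1 guards against
    \<open>B = 0\<close>.\<close>
  define h where "h = min (e / 2) ((1 - \<bar>denom [i] t\<bar>) / (B + 1))"
  have h: "0 < h" "h < e" using e lt B by (auto simp: h_def)
  have "B * h < 1 - \<bar>denom [i] t\<bar>"
  proof -
    have "B * h < (B + 1) * h" using h by (simp add: distrib_right)
    also have "\<dots> \<le> (B + 1) * ((1 - \<bar>denom [i] t\<bar>) / (B + 1))"
      using B by (intro mult_left_mono) (auto simp: h_def)
    finally show ?thesis using B by simp
  qed
  then have ls: "\<bar>denom [i] (t + h)\<bar> < 1" using B(2)[of "t + h"] h by simp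
  have s: "t + h \<in> \<phi> ` V" using e h by simp
  have il: "[i] \<in> lists {1..m}" using i by simp
  have "h = \<bar>chart_map [i] (t + h) - chart_map [i] t\<bar> * (\<bar>denom [i] (t + h)\<bar> * \<bar>denom [i] t\<bar>)"
    using chart_map_diff[OF il s t] h by simp
  also have "\<dots> \<le> (L * h) * (1 * 1)"
    using chart_map_contraction[OF il s t] lt ls h L by (intro mult_mono) auto
  also have "\<dots> < h" using L h by simp
  finally show False by simp
qed

text \<open>Changing the argument in the denominator of one letter costs an additive error of order
  \<open>L ^ length I\<close>, where \<open>I\<close> is the word applied before it; as that
  denominator is at least 1 in absolute value, the error is also relative. The resulting factors are
  bounded by exponentials whose exponents form a geometric series.\<close>

lemma distortion:
  "\<exists>Q>0. \<forall>I\<in>lists {1..m}. \<forall>t\<in>\<phi> ` V. \<forall>s\<in>\<phi> ` V. \<bar>denom I t\<bar> \<le> Q * \<bar>denom I s\<bar>"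
proof -
  obtain k where k: "k > 0" "\<And>t. t \<in> \<phi> ` V \<Longrightarrow> norm (v t) \<le> k" using bounded_v by blast
  obtain B where B: "B \<ge> 0" "\<And>i s t. i \<in> {1..m} \<Longrightarrow> \<bar>denom [i] t - denom [i] s\<bar> \<le> B * \<bar>t - s\<bar>"
    using denom_lipschitz by blast
  \<comment> \<open>A coordinate is recovered as \<open>\<alpha> \<bullet> v t\<close>, so the bound
    on chart vectors bounds the coordinates, and \<open>D\<close> their differences.\<close>
  define D where "D = 2 * (norm \<alpha> * k)"
  have D: "\<bar>t - s\<bar> \<le> D" if "t \<in> \<phi> ` V" "s \<in> \<phi> ` V" for t s
  proof -
    have "\<bar>t\<bar> \<le> norm \<alpha> * k" if "t \<in> \<phi> ` V" for t
    proof -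
      have "\<bar>t\<bar> = \<bar>\<alpha> \<bullet> v t\<bar>" by (simp add: inner_chart_vec[OF area_nz])
      also have "\<dots> \<le> norm \<alpha> * norm (v t)" by (rule Cauchy_Schwarz_ineq2)
      also have "\<dots> \<le> norm \<alpha> * k" using k that by (intro mult_left_mono) auto
      finally show ?thesis .
    qed
    from this[OF that(1)] this[OF that(2)] show ?thesis by (simp add: D_def)
  qed
  have D0: "0 \<le> D" using k by (simp add: D_def)
  \<comment> \<open>The partial geometric sum is kept in the induction, so that prepending a letter
    adds exactly the next term.\<close>
  have main: "\<bar>denom I t\<bar> \<le> exp (B * D * (\<Sum>j<length I. L ^ j)) * \<bar>denom I s\<bar>"
    if "I \<in> lists {1..m}" "t \<in> \<phi> ` V" "s \<in> \<phi> ` V" for I t s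
    using that(1)
  proof (induction I)
    case Nil
    then show ?case by (simp add: denom_def inner_chart_vec[OF area_nz])
  next
    case (Cons i I)
    then have I: "i \<in> {1..m}" "I \<in> lists {1..m}" by auto
    let ?t = "chart_map I t" and ?s = "chart_map I s"
    have ts: "?t \<in> \<phi> ` V" "?s \<in> \<phi> ` V" using chart_map_in[OF I(2)] that by auto
    have "\<bar>denom [i] ?t\<bar> \<le> \<bar>denom [i] ?s\<bar> + B * \<bar>?t - ?s\<bar>"
      using B(2)[OF I(1), of ?t ?s] by linarith
    also have "B * \<bar>?t - ?s\<bar> \<le> B * (L ^ length I * D)"
    proof -
      have "\<bar>?t - ?s\<bar> \<le> L ^ length I * \<bar>t - s\<bar>" by (rule chart_map_contraction[OF I(2) that(2,3)])
      also have "\<dots> \<le> L ^ length I * D" using D[OF that(2,3)] L by (intro mult_left_mono) auto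
      finally show ?thesis using B by (intro mult_left_mono)
    qed
    also have "\<dots> \<le> B * (L ^ length I * D) * \<bar>denom [i] ?s\<bar>"
      using mult_left_mono[OF denom_ge_1[OF I(1) ts(2)], of "B * (L ^ length I * D)"] B D0 L by simp
    also have "\<bar>denom [i] ?s\<bar> + B * (L ^ length I * D) * \<bar>denom [i] ?s\<bar>
        = (1 + B * (L ^ length I * D)) * \<bar>denom [i] ?s\<bar>" by (simp add: distrib_right)
    also have "\<dots> \<le> exp (B * (L ^ length I * D)) * \<bar>denom [i] ?s\<bar>"
      by (intro mult_right_mono exp_ge_add_one_self) auto
    finally have step: "\<bar>denom [i] ?t\<bar> \<le> exp (B * (L ^ length I * D)) * \<bar>denom [i] ?s\<bar>" by simp
    have "\<bar>denom (i # I) t\<bar> = \<bar>denom I t\<bar> * \<bar>denom [i] ?t\<bar>"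
      by (simp add: denom_Cons[OF I that(2)] abs_mult)
    also have "\<dots> \<le> (exp (B * D * (\<Sum>j<length I. L ^ j)) * \<bar>denom I s\<bar>) *
        (exp (B * (L ^ length I * D)) * \<bar>denom [i] ?s\<bar>)"
      using Cons step by (intro mult_mono) auto
    also have "\<dots> = exp (B * D * (\<Sum>j<length (i # I). L ^ j)) * \<bar>denom (i # I) s\<bar>"
      by (simp add: denom_Cons[OF I that(3)] abs_mult exp_add distrib_left mult_ac)
    finally show ?case .
  qed
  have "\<bar>denom I t\<bar> \<le> exp (B * D * (1 / (1 - L))) * \<bar>denom I s\<bar>"
    if "I \<in> lists {1..m}" "t \<in> \<phi> ` V" "s \<in> \<phi> ` V" for I t s
  proof -
    have "(\<Sum>j<length I. L ^ j) \<le> (\<Sum>j. L ^ j)"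
      using L by (intro sum_le_suminf summable_geometric) auto
    also have "\<dots> = 1 / (1 - L)" using L by (intro suminf_geometric) auto
    finally have "B * D * (\<Sum>j<length I. L ^ j) \<le> B * D * (1 / (1 - L))"
      using B D0 by (intro mult_left_mono) auto
    then have "exp (B * D * (\<Sum>j<length I. L ^ j)) \<le> exp (B * D * (1 / (1 - L)))"
      by (simp only: exp_le_cancel_iff)
    then show ?thesis
      using main[OF that] by (meson abs_ge_zero mult_right_mono order_trans)
  qed
  then show ?thesis by (intro exI[of _ "exp (B * D * (1 / (1 - L)))"]) auto
qed

section \<open>Denominators against matrix norms\<close>

lemma two_coords: "\<exists>t\<in>\<phi> ` V. \<exists>s\<in>\<phi> ` V. t \<noteq> s"
proof -
  obtain t where t: "t \<in> \<phi> ` V" using V_ne by blast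
  obtain e where e: "e > 0" "\<And>s. \<bar>s - t\<bar> < e \<Longrightarrow> s \<in> \<phi> ` V" using chart_open[OF t] by blast
  then have "t + e / 2 \<in> \<phi> ` V" "t \<noteq> t + e / 2" by auto
  with t show ?thesis by blast
qed

text \<open>The upper bound is Cauchy-Schwarz. For the lower one, the matrix is controlled by the
  images of two independent chart vectors, whose lengths are at most a constant times the
  denominators there; distortion replaces these two base points by an arbitrary
  \<open>t\<close>.\<close>

lemma denom_bounds:
  "\<exists>a>0. \<exists>a'>0. \<forall>I\<in>lists {1..m}. \<forall>t\<in>\<phi> ` V.
     a * max_norm (word_matrix A I) \<le> \<bar>denom I t\<bar> \<and> \<bar>denom I t\<bar> \<le> a' * max_norm (word_matrix A I)"
proof -
  obtain k where k: "k > 0" "\<And>t. t \<in> \<phi> ` V \<Longrightarrow> norm (v t) \<le> k" using bounded_v by blast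
  obtain Q where Q: "Q > 0" "\<And>I t s. I \<in> lists {1..m} \<Longrightarrow> t \<in> \<phi> ` V \<Longrightarrow> s \<in> \<phi> ` V \<Longrightarrow>
      \<bar>denom I t\<bar> \<le> Q * \<bar>denom I s\<bar>" using distortion by blast
  obtain t1 t2 where t: "t1 \<in> \<phi> ` V" "t2 \<in> \<phi> ` V" "t1 \<noteq> t2" using two_coords by blast
  have "area (v t1) (v t2) \<noteq> 0" using t(3) area_nz by (simp add: area_chart_vec[OF area_nz])
  then obtain k1 where k1: "k1 > 0" "\<And>F M. linear F \<Longrightarrow> represents b F M \<Longrightarrow>
      max_norm M \<le> k1 * (norm (F (v t1)) + norm (F (v t2)))"
    using max_norm_le_norm[OF basis] by blast
  obtain k2 where k2: "k2 > 0" "\<And>F M x. linear F \<Longrightarrow> represents b F M \<Longrightarrow>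
      norm (F x) \<le> k2 * max_norm M * norm x"
    using norm_le_max_norm[OF basis] by blast
  have "max_norm (word_matrix A I) \<le> (k1 * (2 * (Q * k))) * \<bar>denom I t\<bar>"
    and "\<bar>denom I t\<bar> \<le> (norm \<beta> * k2 * k) * max_norm (word_matrix A I)"
    if I: "I \<in> lists {1..m}" and t0: "t \<in> \<phi> ` V" for I t
  proof -
    have 1: "norm (word_map f I (v s)) \<le> Q * k * \<bar>denom I t\<bar>" if s: "s \<in> \<phi> ` V" for s
    proof -
      have "norm (word_map f I (v s)) = \<bar>denom I s\<bar> * norm (v (chart_map I s))"
        by (simp add: word_map_f_v[OF I s])
      also have "\<dots> \<le> (Q * \<bar>denom I t\<bar>) * k"
        using Q(1) by (intro mult_mono Q(2) k(2) I s t0 chart_map_in) auto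
      finally show ?thesis by (simp add: mult_ac)
    qed
    have "max_norm (word_matrix A I) \<le> k1 * (norm (word_map f I (v t1)) + norm (word_map f I (v t2)))"
      by (intro k1 word_map_f represents_word I)
    also have "\<dots> \<le> k1 * (Q * k * \<bar>denom I t\<bar> + Q * k * \<bar>denom I t\<bar>)"
      using k1 1[OF t(1)] 1[OF t(2)] by (intro mult_left_mono add_mono) auto
    finally show "max_norm (word_matrix A I) \<le> (k1 * (2 * (Q * k))) * \<bar>denom I t\<bar>"
      by (simp add: algebra_simps)
    have N0: "0 \<le> max_norm (word_matrix A I)"
      using max_norm_ge[of "word_matrix A I" 1 1] by linarith
    have "\<bar>denom I t\<bar> \<le> norm \<beta> * norm (word_map f I (v t))"
      unfolding denom_def by (rule Cauchy_Schwarz_ineq2)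
    also have "\<dots> \<le> norm \<beta> * (k2 * max_norm (word_matrix A I) * norm (v t))"
      by (intro mult_left_mono k2 word_map_f represents_word I) auto
    also have "\<dots> \<le> norm \<beta> * (k2 * max_norm (word_matrix A I) * k)"
      using k2 N0 by (intro mult_left_mono k(2) t0) auto
    finally show "\<bar>denom I t\<bar> \<le> (norm \<beta> * k2 * k) * max_norm (word_matrix A I)"
      by (simp add: mult_ac)
  qed
  moreover have "0 < k1 * (2 * (Q * k))" "0 < norm \<beta> * k2 * k"
    using k k1 k2 Q \<beta>_neq_0 by auto
  ultimately show ?thesis
    by (intro exI[of _ "1 / (k1 * (2 * (Q * k)))"] exI[of _ "norm \<beta> * k2 * k"] conjI)
      (auto simp: divide_le_eq mult.commute)
qed

lemma max_norm_word_pos: "I \<in> lists {1..m} \<Longrightarrow> 0 < max_norm (word_matrix A I)"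
proof -
  assume I: "I \<in> lists {1..m}"
  obtain a' t where "a' > 0" "t \<in> \<phi> ` V" "\<bar>denom I t\<bar> \<le> a' * max_norm (word_matrix A I)"
    using denom_bounds I two_coords by blast
  then have "0 < a' * max_norm (word_matrix A I)" using denom_neq_0[OF I] by force
  with \<open>a' > 0\<close> show ?thesis by (simp add: zero_less_mult_iff)
qed

text \<open>The exponent -2 reflects the two denominators in the two-point formula, each comparable
  with the norm of the matrix.\<close>

lemma conformal:
  "\<exists>c C K. conformal_ifs m \<psi> V (\<lambda>I. max_norm (word_matrix A I) powr (-2)) c C K L"
proof -
  define N where "N = (\<lambda>I. max_norm (word_matrix A I))"
  obtain k where k: "k > 0" "\<And>t. t \<in> \<phi> ` V \<Longrightarrow> norm (v t) \<le> k" using bounded_v by blast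
  obtain a a' where a: "a > 0" "a' > 0"
    "\<And>I t. I \<in> lists {1..m} \<Longrightarrow> t \<in> \<phi> ` V \<Longrightarrow> a * N I \<le> \<bar>denom I t\<bar>"
    "\<And>I t. I \<in> lists {1..m} \<Longrightarrow> t \<in> \<phi> ` V \<Longrightarrow> \<bar>denom I t\<bar> \<le> a' * N I"
    using denom_bounds unfolding N_def by blast
  define c1 where "c1 = 1 / (\<bar>area \<alpha> \<beta>\<bar> * k\<^sup>2)"
  define c2 where "c2 = 2 * (norm \<beta>)\<^sup>2 / \<bar>area \<alpha> \<beta>\<bar>"
  have c: "c1 > 0" "c2 > 0" using k area_nz \<beta>_neq_0 by (auto simp: c1_def c2_def)
  have N: "0 < N I" if "I \<in> lists {1..m}" for I using that max_norm_word_pos by (simp add: N_def)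
  have powr2: "N I powr (-2) = 1 / (N I)\<^sup>2" if "I \<in> lists {1..m}" for I
    using N[OF that] by (simp add: powr_minus divide_inverse powr_numeral)
  have chart: "1 / a'\<^sup>2 * N I powr (-2) * \<bar>t - s\<bar> \<le> \<bar>chart_map I t - chart_map I s\<bar>"
      "\<bar>chart_map I t - chart_map I s\<bar> \<le> 1 / a\<^sup>2 * N I powr (-2) * \<bar>t - s\<bar>"
    if I: "I \<in> lists {1..m}" and ts: "t \<in> \<phi> ` V" "s \<in> \<phi> ` V" for I t s
  proof -
    let ?g = "\<bar>denom I t\<bar> * \<bar>denom I s\<bar>"
    have g: "0 < ?g" using denom_neq_0[OF I] ts by simp
    have eq: "\<bar>chart_map I t - chart_map I s\<bar> = \<bar>t - s\<bar> / ?g"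
      using chart_map_diff[OF I ts] g by (metis less_irrefl nonzero_eq_divide_eq)
    have "?g \<le> (a' * N I) * (a' * N I)"
      using a(4)[OF I] ts a N[OF I] by (intro mult_mono) auto
    then have "\<bar>t - s\<bar> / ((a' * N I) * (a' * N I)) \<le> \<bar>t - s\<bar> / ?g"
      using g by (intro divide_left_mono) auto
    then show "1 / a'\<^sup>2 * N I powr (-2) * \<bar>t - s\<bar> \<le> \<bar>chart_map I t - chart_map I s\<bar>"
      by (simp add: eq powr2[OF I] power2_eq_square mult_ac)
    have "(a * N I) * (a * N I) \<le> ?g"
      using a(3)[OF I] ts a N[OF I] by (intro mult_mono) auto
    then have "\<bar>t - s\<bar> / ?g \<le> \<bar>t - s\<bar> / ((a * N I) * (a * N I))"
      using g a N[OF I] by (intro divide_left_mono) auto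
    then show "\<bar>chart_map I t - chart_map I s\<bar> \<le> 1 / a\<^sup>2 * N I powr (-2) * \<bar>t - s\<bar>"
      by (simp add: eq powr2[OF I] power2_eq_square mult_ac)
  qed
  have d: "c1 * \<bar>\<phi> p - \<phi> q\<bar> \<le> dist p q" "dist p q \<le> c2 * \<bar>\<phi> p - \<phi> q\<bar>" if "p \<in> V" "q \<in> V" for p q
  proof -
    note V = V_coord[OF that(1)] V_coord[OF that(2)]
    show "c1 * \<bar>\<phi> p - \<phi> q\<bar> \<le> dist p q"
      using dist_chart_ge[OF k(2)[OF V(2)] k(2)[OF V(4)]] unfolding c1_def V(1,3)[symmetric] .
    show "dist p q \<le> c2 * \<bar>\<phi> p - \<phi> q\<bar>"
      using dist_chart_le[of "\<phi> p" "\<phi> q"] unfolding c2_def V(1,3)[symmetric] .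
  qed
  have \<phi>_word: "\<phi> (word_map \<psi> I p) = chart_map I (\<phi> p)" if "p \<in> V" for I p
    using V_coord(1)[OF that] by (simp add: chart_map_def)
  \<comment> \<open>Passing between the round metric and the chart costs one factor
    \<open>c1\<close> and one factor \<open>c2\<close>; the squares of \<open>a\<close> and
    \<open>a'\<close> come from the two denominators.\<close>
  have "conformal_ifs m \<psi> V (\<lambda>I. N I powr (-2)) (c1 / (a'\<^sup>2 * c2)) (c2 / (a\<^sup>2 * c1)) (a'\<^sup>2) L"
  proof
    show "compact (UNIV :: rp1 set)" by (rule compact_UNIV_rp1)
    show "open V" "open_set_condition m \<psi> V" "0 < L" "L < 1" by (rule open_V osc L)+
    show "0 < c1 / (a'\<^sup>2 * c2)" "0 < c2 / (a\<^sup>2 * c1)" using a c by auto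
    fix I assume I: "I \<in> lists {1..m}"
    show "0 < N I powr (-2)" using N[OF I] by simp
    \<comment> \<open>Decay is read off from the contraction: at two distinct coordinates the lower
      estimate for the distance of the images cannot exceed \<open>L ^ length I\<close> times the
      original distance.\<close>
    show "N I powr (-2) \<le> a'\<^sup>2 * L ^ length I"
    proof -
      obtain t s where ts: "t \<in> \<phi> ` V" "s \<in> \<phi> ` V" "t \<noteq> s" using two_coords by blast
      have "1 / a'\<^sup>2 * N I powr (-2) * \<bar>t - s\<bar> \<le> L ^ length I * \<bar>t - s\<bar>"
        using chart(1)[OF I ts(1,2)] chart_map_contraction[OF I ts(1,2)] by linarith
      then have "1 / a'\<^sup>2 * N I powr (-2) \<le> L ^ length I"
        by (rule mult_right_le_imp_le) (use ts in simp)
      then show ?thesis using a by (simp add: divide_le_eq mult.commute)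
    qed
    fix p q assume pq: "p \<in> V" "q \<in> V"
    let ?p = "word_map \<psi> I p" and ?q = "word_map \<psi> I q"
    have V: "?p \<in> V" "?q \<in> V" "\<phi> p \<in> \<phi> ` V" "\<phi> q \<in> \<phi> ` V"
      using word_map_mem[OF osc I] pq by auto
    have "c1 / (a'\<^sup>2 * c2) * N I powr (-2) * dist p q
        \<le> c1 / (a'\<^sup>2 * c2) * N I powr (-2) * (c2 * \<bar>\<phi> p - \<phi> q\<bar>)"
      using c a by (intro mult_left_mono d pq) auto
    also have "\<dots> = c1 * (1 / a'\<^sup>2 * N I powr (-2) * \<bar>\<phi> p - \<phi> q\<bar>)" using c by simp
    also have "\<dots> \<le> c1 * \<bar>\<phi> ?p - \<phi> ?q\<bar>"
      unfolding \<phi>_word[OF pq(1)] \<phi>_word[OF pq(2)] using c by (intro mult_left_mono chart I V) auto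
    also have "\<dots> \<le> dist ?p ?q" by (intro d V)
    finally show "c1 / (a'\<^sup>2 * c2) * N I powr (-2) * dist p q \<le> dist ?p ?q" .
    have "dist ?p ?q \<le> c2 * \<bar>\<phi> ?p - \<phi> ?q\<bar>" by (intro d V)
    also have "\<dots> \<le> c2 * (1 / a\<^sup>2 * N I powr (-2) * \<bar>\<phi> p - \<phi> q\<bar>)"
      unfolding \<phi>_word[OF pq(1)] \<phi>_word[OF pq(2)] using c by (intro mult_left_mono chart I V) auto
    also have "\<dots> = c2 / (a\<^sup>2 * c1) * N I powr (-2) * (c1 * \<bar>\<phi> p - \<phi> q\<bar>)" using c by simp
    also have "\<dots> \<le> c2 / (a\<^sup>2 * c1) * N I powr (-2) * dist p q"
      using c a by (intro mult_left_mono d pq) auto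
    finally show "dist ?p ?q \<le> c2 / (a\<^sup>2 * c1) * N I powr (-2) * dist p q" .
  qed
  then show ?thesis unfolding N_def by blast
qed

end

text \<open>For \<open>m\<close> at least 2, the last assumption rules out a \<open>V\<close> with
  empty residual set; there the left side would be 0 although the exponent can be positive.\<close>

theorem theorem4:
  fixes m :: nat
    and f :: "nat \<Rightarrow> real^2 \<Rightarrow> real^2"
    and b :: "2 \<Rightarrow> real^2"
    and A :: "nat \<Rightarrow> real^2^2"
    and \<psi> :: "nat \<Rightarrow> rp1 \<Rightarrow> rp1"
    and V D :: "rp1 set"
    and \<phi> :: "rp1 \<Rightarrow> real"
  assumes "m \<ge> 1"
    and "\<And>i. i \<in> {1..m} \<Longrightarrow> linear (f i) \<and> bij (f i) \<and> preserves_area_up_to_sign (f i)"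
    and "is_basis b"
    and "\<And>i. i \<in> {1..m} \<Longrightarrow> A i \<in> SL2pm \<and> represents b (f i) (A i)"
    and "\<And>i. i \<in> {1..m} \<Longrightarrow> \<psi> i = proj_map (f i)"
    and "open V" "V \<noteq> {}" "V \<noteq> UNIV"
    and "open_set_condition m \<psi> V"
    and "affine_chart D \<phi>" "closure V \<subseteq> D"
    and "\<And>i. i \<in> {1..m} \<Longrightarrow>
           contraction_on (\<phi> ` closure V) (\<phi> \<circ> \<psi> i \<circ> inv_into D \<phi>)"
    and "m \<ge> 2 \<Longrightarrow> residual_set m \<psi> V \<noteq> {}"
  shows "2 * hausdorff_dim (residual_set m \<psi> V) = exponent m A"
proof -
  from \<open>affine_chart D \<phi>\<close> obtain \<alpha> \<beta> where nz: "area \<alpha> \<beta> \<noteq> 0" and D: "D = proj ` {x. \<beta> \<bullet> x \<noteq> 0}"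
    and \<phi>: "\<And>x. \<beta> \<bullet> x \<noteq> 0 \<Longrightarrow> \<phi> (proj x) = (\<alpha> \<bullet> x) / (\<beta> \<bullet> x)"
    unfolding affine_chart_def by metis
  \<comment> \<open>A point of \<open>D\<close> is the line through the chart vector of its
    coordinate. Injectivity lets \<open>inv_into\<close> be cancelled in the contraction
    hypothesis.\<close>
  have inj: "inj_on \<phi> D"
  proof (rule inj_onI)
    fix p q assume "p \<in> D" "q \<in> D" "\<phi> p = \<phi> q"
    then obtain x y where xy: "\<beta> \<bullet> x \<noteq> 0" "\<beta> \<bullet> y \<noteq> 0" "p = proj x" "q = proj y"
      and eq: "\<phi> (proj x) = \<phi> (proj y)" unfolding D by blast
    let ?w = "chart_vec \<alpha> \<beta> (\<phi> (proj x))"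
    have "x = (\<beta> \<bullet> x) *\<^sub>R ?w" "y = (\<beta> \<bullet> y) *\<^sub>R ?w"
      by (rule chart_vec_eqI[OF nz], simp add: \<phi> xy,
          rule chart_vec_eqI[OF nz], simp add: eq, simp add: \<phi> xy)
    then show "p = q" using xy by (metis proj_scaleR)
  qed
  obtain l where l: "\<And>i. i \<in> {1..m} \<Longrightarrow> l i < 1 \<and>
      (l i)-lipschitz_on (\<phi> ` closure V) (\<phi> \<circ> \<psi> i \<circ> inv_into D \<phi>)"
    using assms(12) unfolding contraction_on_def by metis
  \<comment> \<open>The value 1/2 is inserted because the given Lipschitz constants may all be 0,
    whereas \<open>L\<close> has to be positive.\<close>
  define L where "L = Max (insert (1/2) (l ` {1..m}))"
  have L: "1/2 \<le> L" "L < 1" "\<And>i. i \<in> {1..m} \<Longrightarrow> l i \<le> L"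
  proof -
    show "1/2 \<le> L" unfolding L_def by (intro Max_ge) auto
    show "L < 1" unfolding L_def using l by (subst Max_less_iff) auto
    show "l i \<le> L" if "i \<in> {1..m}" for i unfolding L_def using that by (intro Max_ge) auto
  qed
  interpret projective_ifs m f \<psi> V \<alpha> \<beta> \<phi> L b A
  proof
    show "0 < L" "L < 1" using L by auto
    show "closure V \<subseteq> proj ` {x. \<beta> \<bullet> x \<noteq> 0}" using \<open>closure V \<subseteq> D\<close> D by simp
    fix i p q assume i: "i \<in> {1..m}" and pq: "p \<in> V" "q \<in> V"
    have inv: "inv_into D \<phi> (\<phi> p) = p" if "p \<in> V" for p
      using that inj \<open>closure V \<subseteq> D\<close> closure_subset[of V] by (intro inv_into_f_f) auto
    have "dist ((\<phi> \<circ> \<psi> i \<circ> inv_into D \<phi>) (\<phi> p)) ((\<phi> \<circ> \<psi> i \<circ> inv_into D \<phi>) (\<phi> q))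
        \<le> l i * dist (\<phi> p) (\<phi> q)"
      using l[OF i] pq closure_subset[of V] by (intro lipschitz_onD[of "l i"]) auto
    also have "\<dots> \<le> L * dist (\<phi> p) (\<phi> q)"
      using L(3)[OF i] by (intro mult_right_mono) auto
    finally show "\<bar>\<phi> (\<psi> i p) - \<phi> (\<psi> i q)\<bar> \<le> L * \<bar>\<phi> p - \<phi> q\<bar>"
      by (simp add: inv pq dist_real_def)
  qed (use assms nz \<phi> in auto)
  define \<rho> where "\<rho> = (\<lambda>I. max_norm (word_matrix A I) powr (-2))"
  obtain c C K where "conformal_ifs m \<psi> V \<rho> c C K L"
    using conformal unfolding \<rho>_def by blast
  then interpret C: conformal_ifs m \<psi> V \<rho> c C K L .
  define T where "T = {s. 0 \<le> s \<and> (\<Sum>\<^sub>\<infinity>I\<in>lists {1..m}. ennreal (\<rho> I powr s)) = \<infinity>}"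
  \<comment> \<open>Powers of \<rho> are powers of the norm with doubled negative exponent; this
    rescaling produces the factor 2.\<close>
  have "{s. 0 \<le> s \<and> (\<Sum>\<^sub>\<infinity>I\<in>lists {1..m}. ennreal (max_norm (word_matrix A I) powr (-s))) = \<infinity>}
      = (*) 2 ` T"
  proof -
    have eq: "\<rho> I powr s = max_norm (word_matrix A I) powr (- (2 * s))" for I s
      by (simp add: \<rho>_def powr_powr)
    have "s \<in> (*) 2 ` T" if "0 \<le> s"
      "(\<Sum>\<^sub>\<infinity>I\<in>lists {1..m}. ennreal (max_norm (word_matrix A I) powr (-s))) = \<infinity>" for s
      using that by (intro image_eqI[of _ _ "s / 2"]) (auto simp: T_def eq)
    then show ?thesis by (auto simp: T_def eq)
  qed
  then have "exponent m A = (SUP s\<in>T. ennreal (2 * s))"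
    by (simp add: exponent_def image_image)
  also have "\<dots> = (SUP s\<in>T. 2 * ennreal s)"
    by (intro SUP_cong refl) (auto simp: T_def ennreal_mult)
  also have "\<dots> = 2 * (SUP s\<in>T. ennreal s)"
    by (simp add: SUP_mult_left_ennreal)
  also have "(SUP s\<in>T. ennreal s) = hausdorff_dim (residual_set m \<psi> V)"
    unfolding T_def using C.hausdorff_dim_residual_set assms(1,13) by simp
  finally show ?thesis by simp
qed

end
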